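(* For every compact set $\Omega$ with $\{0,1\}\subset\Omega\subset[0,\infty)$, there exists a scaling element $X$ (in some $C^*$-algebra) with $\mathrm{sp}(|X^*|)=\Omega$. If in addition $\Omega\setminus\{0,1\}$ is non-empty and compact, then there exist both a proper scaling element $X$ with $\mathrm{sp}(|X^*|)=\Omega$ and a non-proper scaling element $Y$ with $\mathrm{sp}(|Y^*|)=\Omega$.
   Context: An element $X$ of a $C^*$-algebra is a scaling element if $(X^*X)X=X$ and $X^*X\neq XX^*$. Here $|X|=(X^*X)^{1/2}$, $|X^*|=(XX^* )^{1/2}$, $\mathrm{sp}$ denotes the spectrum (taken in the unitization if the algebra is non-unital), and $1_C$ is the characteristic function of a set $C$. For every scaling element $X$ one has $0,1\in\mathrm{sp}(|X^*|)\subset[0,\infty)$, and $\mathrm{sp}(|X|)\cup\{0\}=\mathrm{sp}(|X^*|)$. A scaling element $X$ is called non-proper if $\mathrm{sp}(|X^*|)\setminus\{0,1\}$ is compact and $1_{\{1\}}(|X|)=1_{\mathrm{sp}(|X^*|)\setminus\{0\}}(|X^*|)$ (functional calculus; when $\mathrm{sp}(|X^*|)\setminus\{0,1\}$ is compact these functions are continuous on the relevant spectra). Otherwise $X$ is called proper. *)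

theory Defs
  imports "HOL-Analysis.Analysis"
begin

record 'a cstar =
  elems :: "'a set"
  azero :: 'a (\<open>\<zero>\<index>\<close>)
  aadd :: "'a \<Rightarrow> 'a \<Rightarrow> 'a" (infixl \<open>\<oplus>\<index>\<close> 65)
  ascale :: "complex \<Rightarrow> 'a \<Rightarrow> 'a" (infixr \<open>\<odot>\<index>\<close> 75)
  amult :: "'a \<Rightarrow> 'a \<Rightarrow> 'a" (infixl \<open>\<otimes>\<index>\<close> 70)
  astar :: "'a \<Rightarrow> 'a"
  anorm :: "'a \<Rightarrow> real"

definition aminus :: "('a, 'm) cstar_scheme \<Rightarrow> 'a \<Rightarrow> 'a \<Rightarrow> 'a" where
  "aminus A x y = aadd A x (ascale A (- 1) y)"

text \<open>A C*-algebra, not assumed to have a unit.\<close>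

locale cstar_algebra =
  fixes A :: "('a, 'm) cstar_scheme" (structure)
  assumes zero_closed: "\<zero> \<in> elems A"
    and add_closed: "\<lbrakk>x \<in> elems A; y \<in> elems A\<rbrakk> \<Longrightarrow> x \<oplus> y \<in> elems A"
    and scale_closed: "x \<in> elems A \<Longrightarrow> c \<odot> x \<in> elems A"
    and mult_closed: "\<lbrakk>x \<in> elems A; y \<in> elems A\<rbrakk> \<Longrightarrow> x \<otimes> y \<in> elems A"
    and star_closed: "x \<in> elems A \<Longrightarrow> astar A x \<in> elems A"
    and add_assoc: "\<lbrakk>x \<in> elems A; y \<in> elems A; z \<in> elems A\<rbrakk> \<Longrightarrow> x \<oplus> y \<oplus> z = x \<oplus> (y \<oplus> z)"
    and add_commute: "\<lbrakk>x \<in> elems A; y \<in> elems A\<rbrakk> \<Longrightarrow> x \<oplus> y = y \<oplus> x"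
    and add_zero: "x \<in> elems A \<Longrightarrow> x \<oplus> \<zero> = x"
    and add_uminus: "x \<in> elems A \<Longrightarrow> x \<oplus> (- 1) \<odot> x = \<zero>"
    and scale_add: "\<lbrakk>x \<in> elems A; y \<in> elems A\<rbrakk> \<Longrightarrow> c \<odot> (x \<oplus> y) = c \<odot> x \<oplus> c \<odot> y"
    and add_scale: "x \<in> elems A \<Longrightarrow> (c + d) \<odot> x = c \<odot> x \<oplus> d \<odot> x"
    and scale_scale: "x \<in> elems A \<Longrightarrow> c \<odot> d \<odot> x = (c * d) \<odot> x"
    and scale_one: "x \<in> elems A \<Longrightarrow> 1 \<odot> x = x"
    and mult_assoc: "\<lbrakk>x \<in> elems A; y \<in> elems A; z \<in> elems A\<rbrakk> \<Longrightarrow> x \<otimes> y \<otimes> z = x \<otimes> (y \<otimes> z)"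
    and mult_add: "\<lbrakk>x \<in> elems A; y \<in> elems A; z \<in> elems A\<rbrakk> \<Longrightarrow> x \<otimes> (y \<oplus> z) = x \<otimes> y \<oplus> x \<otimes> z"
    and add_mult: "\<lbrakk>x \<in> elems A; y \<in> elems A; z \<in> elems A\<rbrakk> \<Longrightarrow> (x \<oplus> y) \<otimes> z = x \<otimes> z \<oplus> y \<otimes> z"
    and scale_mult_left: "\<lbrakk>x \<in> elems A; y \<in> elems A\<rbrakk> \<Longrightarrow> (c \<odot> x) \<otimes> y = c \<odot> (x \<otimes> y)"
    and scale_mult_right: "\<lbrakk>x \<in> elems A; y \<in> elems A\<rbrakk> \<Longrightarrow> x \<otimes> (c \<odot> y) = c \<odot> (x \<otimes> y)"
    and star_star: "x \<in> elems A \<Longrightarrow> astar A (astar A x) = x"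
    and star_add: "\<lbrakk>x \<in> elems A; y \<in> elems A\<rbrakk> \<Longrightarrow> astar A (x \<oplus> y) = astar A x \<oplus> astar A y"
    and star_scale: "x \<in> elems A \<Longrightarrow> astar A (c \<odot> x) = cnj c \<odot> astar A x"
    and star_mult: "\<lbrakk>x \<in> elems A; y \<in> elems A\<rbrakk> \<Longrightarrow> astar A (x \<otimes> y) = astar A y \<otimes> astar A x"
    and norm_eq_zero: "x \<in> elems A \<Longrightarrow> anorm A x = 0 \<longleftrightarrow> x = \<zero>"
    and norm_triangle: "\<lbrakk>x \<in> elems A; y \<in> elems A\<rbrakk> \<Longrightarrow> anorm A (x \<oplus> y) \<le> anorm A x + anorm A y"
    and norm_scale: "x \<in> elems A \<Longrightarrow> anorm A (c \<odot> x) = cmod c * anorm A x"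
    and norm_mult: "\<lbrakk>x \<in> elems A; y \<in> elems A\<rbrakk> \<Longrightarrow> anorm A (x \<otimes> y) \<le> anorm A x * anorm A y"
    and norm_star_mult: "x \<in> elems A \<Longrightarrow> anorm A (astar A x \<otimes> x) = (anorm A x)\<^sup>2"
    and complete: "Metric_space.mcomplete (elems A) (\<lambda>x y. anorm A (aminus A x y))"

definition is_unit_of :: "('a, 'm) cstar_scheme \<Rightarrow> 'a \<Rightarrow> bool" where
  "is_unit_of A e \<longleftrightarrow> e \<in> elems A \<and> (\<forall>x\<in>elems A. amult A e x = x \<and> amult A x e = x)"

definition unital :: "('a, 'm) cstar_scheme \<Rightarrow> bool" where
  "unital A \<longleftrightarrow> (\<exists>e. is_unit_of A e)"

definition aunit :: "('a, 'm) cstar_scheme \<Rightarrow> 'a" where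
  "aunit A = (THE e. is_unit_of A e)"

definition ainvertible :: "('a, 'm) cstar_scheme \<Rightarrow> 'a \<Rightarrow> bool" where
  "ainvertible A x \<longleftrightarrow> x \<in> elems A \<and> (\<exists>y\<in>elems A. amult A x y = aunit A \<and> amult A y x = aunit A)"

text \<open>
  The pair \<open>(x, c)\<close> stands for \<open>x + c 1\<close>, and its norm is that of left multiplication by
  \<open>x + c 1\<close> on \<open>A\<close>; this is the C*-norm when \<open>A\<close> is not unital.
\<close>

definition unitization :: "('a, 'm) cstar_scheme \<Rightarrow> ('a \<times> complex) cstar" where
  "unitization A = \<lparr>
     elems = elems A \<times> UNIV,
     azero = (azero A, 0),
     aadd = (\<lambda>(x, c) (y, d). (aadd A x y, c + d)),
     ascale = (\<lambda>k (x, c). (ascale A k x, k * c)),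
     amult = (\<lambda>(x, c) (y, d).
       (aadd A (aadd A (amult A x y) (ascale A d x)) (ascale A c y), c * d)),
     astar = (\<lambda>(x, c). (astar A x, cnj c)),
     anorm = (\<lambda>(x, c).
       SUP b\<in>{b\<in>elems A. anorm A b \<le> 1}. anorm A (aadd A (amult A x b) (ascale A c b)))\<rparr>"

definition unital_spectrum :: "('a, 'm) cstar_scheme \<Rightarrow> 'a \<Rightarrow> complex set" where
  "unital_spectrum A x = {c. \<not> ainvertible A (aminus A x (ascale A c (aunit A)))}"

definition spectrum :: "('a, 'm) cstar_scheme \<Rightarrow> 'a \<Rightarrow> complex set" where
  "spectrum A x =
     (if unital A then unital_spectrum A x else unital_spectrum (unitization A) (x, 0))"

text \<open>
  Continuous functional calculus of a normal element \<open>x\<close>, for the functions on \<open>spectrum A x\<close>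
  that vanish at 0 if 0 is in the spectrum: these are the functions whose value at \<open>x\<close> lies in
  \<open>A\<close> whether or not \<open>A\<close> is unital. The calculus is the isometric *-homomorphism that
  sends the identity function to \<open>x\<close>. If \<open>0 \<notin> spectrum A x\<close> then \<open>A\<close> is
  unital, every continuous function is admitted, and the homomorphism is automatically unital.
\<close>

definition calculus_functions :: "('a, 'm) cstar_scheme \<Rightarrow> 'a \<Rightarrow> (complex \<Rightarrow> complex) set" where
  "calculus_functions A x =
     {f. continuous_on (spectrum A x) f \<and> (0 \<in> spectrum A x \<longrightarrow> f 0 = 0)}"

text \<open>The \<open>insert 0\<close> below matters only for the zero algebra, where spectra are empty.\<close>

definition is_calculus ::
  "('a, 'm) cstar_scheme \<Rightarrow> 'a \<Rightarrow> ((complex \<Rightarrow> complex) \<Rightarrow> 'a) \<Rightarrow> bool" where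
  "is_calculus A x \<phi> \<longleftrightarrow>
     (\<forall>f\<in>calculus_functions A x.
        \<phi> f \<in> elems A \<and>
        anorm A (\<phi> f) = Sup (insert 0 ((\<lambda>z. cmod (f z)) ` spectrum A x)) \<and>
        \<phi> (\<lambda>z. cnj (f z)) = astar A (\<phi> f) \<and>
        (\<forall>c. \<phi> (\<lambda>z. c * f z) = ascale A c (\<phi> f)) \<and>
        (\<forall>g\<in>calculus_functions A x.
           \<phi> (\<lambda>z. f z + g z) = aadd A (\<phi> f) (\<phi> g) \<and>
           \<phi> (\<lambda>z. f z * g z) = amult A (\<phi> f) (\<phi> g))) \<and>
     \<phi> (\<lambda>z. z) = x"

definition fun_calculus :: "('a, 'm) cstar_scheme \<Rightarrow> (complex \<Rightarrow> complex) \<Rightarrow> 'a \<Rightarrow> 'a" where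
  "fun_calculus A f x = (THE y. \<exists>\<phi>. is_calculus A x \<phi> \<and> y = \<phi> f)"

text \<open>On the spectrum of a positive element, \<open>Re z = z\<close>.\<close>

definition pos_sqrt :: "('a, 'm) cstar_scheme \<Rightarrow> 'a \<Rightarrow> 'a" where
  "pos_sqrt A x = fun_calculus A (\<lambda>z. complex_of_real (sqrt (Re z))) x"

definition abs_elem :: "('a, 'm) cstar_scheme \<Rightarrow> 'a \<Rightarrow> 'a" where
  "abs_elem A x = pos_sqrt A (amult A (astar A x) x)"

definition scaling_element :: "('a, 'm) cstar_scheme \<Rightarrow> 'a \<Rightarrow> bool" where
  "scaling_element A X \<longleftrightarrow>
     X \<in> elems A \<and>
     amult A (amult A (astar A X) X) X = X \<and>
     amult A (astar A X) X \<noteq> amult A X (astar A X)"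

definition non_proper_scaling_element :: "('a, 'm) cstar_scheme \<Rightarrow> 'a \<Rightarrow> bool" where
  "non_proper_scaling_element A X \<longleftrightarrow>
     scaling_element A X \<and>
     compact (spectrum A (abs_elem A (astar A X)) - {0, 1}) \<and>
     fun_calculus A (indicator {1}) (abs_elem A X) =
       fun_calculus A (indicator (spectrum A (abs_elem A (astar A X)) - {0}))
         (abs_elem A (astar A X))"

definition proper_scaling_element :: "('a, 'm) cstar_scheme \<Rightarrow> 'a \<Rightarrow> bool" where
  "proper_scaling_element A X \<longleftrightarrow> scaling_element A X \<and> \<not> non_proper_scaling_element A X"

text \<open>
  Statements of the form ``there is a C*-algebra'' need a type for the elements. This one contains
  the bounded operators on the square-summable sequences, hence a copy of every separable
  C*-algebra; the operations and the carrier remain arbitrary.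
\<close>

type_synonym seq_operator = "(nat \<Rightarrow> complex) \<Rightarrow> (nat \<Rightarrow> complex)"

end

theory Submission imports Defs begin

text \<open>
  On the square-summable sequences consider the weighted shift \<open>X\<close> with
  \<open>X e\<^sub>n = a\<^sub>n e\<^sub>2\<^sub>n\<^sub>+\<^sub>1\<close>, where \<open>a\<^sub>n \<ge> 0\<close> is bounded and \<open>a\<^sub>n = 1\<close> for odd \<open>n\<close>. Then
  \<open>|X|\<close> is diagonal with entries \<open>a\<^sub>n\<close>, hence is the identity on the range of \<open>X\<close>, and \<open>|X\<^sup>*|\<close> is
  diagonal with entry \<open>a\<^sub>n\<close> at \<open>2n+1\<close> and \<open>0\<close> at even indices. So \<open>sp(|X\<^sup>*|)\<close> is the closure of
  \<open>{0, 1}\<close> together with the weights at even indices, which are arbitrary apart from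
  \<open>a\<^sub>0 \<noteq> 0\<close>, and \<open>X\<close> is non-proper iff \<open>\<Omega> - {0, 1}\<close> is compact and the
  indices with \<open>a\<^sub>n = 1\<close> are exactly the numbers \<open>2n+1\<close> with \<open>a\<^sub>n \<noteq> 0\<close>. Taking
  \<open>a\<^sub>0 = 1\<close> and the other even weights dense in \<open>\<Omega>\<close> yields a proper element; taking the even
  weights dense in \<open>\<Omega> - {0, 1}\<close> yields a non-proper element.
\<close>

section \<open>The Hilbert space of square-summable sequences\<close>

typedef l2 = "{x :: nat \<Rightarrow> complex. (\<lambda>n. (cmod (x n))\<^sup>2) summable_on UNIV}"
  morphisms coord Abs_l2
  by (rule exI[of _ "\<lambda>_. 0"]) simp

setup_lifting type_definition_l2

section \<open>Summability estimates for the vector space operations and the inner product\<close>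

lemma summable_l2_add:
  assumes "(\<lambda>n. (cmod (x n))\<^sup>2) summable_on UNIV" "(\<lambda>n. (cmod (y n))\<^sup>2) summable_on UNIV"
  shows "(\<lambda>n. (cmod (x n + y n))\<^sup>2) summable_on UNIV"
proof (rule summable_on_comparison_test[OF summable_on_cmult_right[OF summable_on_add[OF assms], of 2]])
  fix n
  have "(cmod (x n + y n))\<^sup>2 \<le> (cmod (x n) + cmod (y n))\<^sup>2"
    by (intro power_mono norm_triangle_ineq) auto
  also have "\<dots> \<le> 2 * ((cmod (x n))\<^sup>2 + (cmod (y n))\<^sup>2)"
    using sum_squares_bound[of "cmod (x n)" "cmod (y n)"] by (simp add: power2_sum)
  finally show "(cmod (x n + y n))\<^sup>2 \<le> 2 * ((cmod (x n))\<^sup>2 + (cmod (y n))\<^sup>2)" .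
qed auto

lemma summable_l2_bounded_mult:
  assumes "(\<lambda>n. (cmod (x n))\<^sup>2) summable_on UNIV" "\<And>n. cmod (d n) \<le> M"
  shows "(\<lambda>n. (cmod (d n * x n))\<^sup>2) summable_on UNIV"
proof (rule summable_on_comparison_test[OF summable_on_cmult_right[OF assms(1), of "M\<^sup>2"]])
  fix n
  show "(cmod (d n * x n))\<^sup>2 \<le> M\<^sup>2 * (cmod (x n))\<^sup>2"
    using assms(2)[of n] by (auto simp: norm_mult power_mult_distrib intro!: mult_right_mono power_mono)
qed auto

lemma summable_l2_inner:
  assumes "(\<lambda>n. (cmod (x n))\<^sup>2) summable_on UNIV" "(\<lambda>n. (cmod (y n))\<^sup>2) summable_on UNIV"
  shows "(\<lambda>n. x n \<bullet> y n) summable_on (UNIV :: nat set)"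
proof -
  have "(\<lambda>n. norm (x n \<bullet> y n)) summable_on UNIV"
  proof (rule summable_on_comparison_test[OF summable_on_add[OF assms]])
    fix n
    have "\<bar>x n \<bullet> y n\<bar> \<le> cmod (x n) * cmod (y n)" by (rule Cauchy_Schwarz_ineq2)
    moreover have "0 \<le> cmod (x n) * cmod (y n)" by simp
    ultimately have "\<bar>x n \<bullet> y n\<bar> \<le> (cmod (x n))\<^sup>2 + (cmod (y n))\<^sup>2"
      using sum_squares_bound[of "cmod (x n)" "cmod (y n)"] unfolding mult.assoc by linarith
    then show "norm (x n \<bullet> y n) \<le> (cmod (x n))\<^sup>2 + (cmod (y n))\<^sup>2" by simp
  qed auto
  then show ?thesis by (rule abs_summable_summable)
qed

instantiation l2 :: real_vector
begin

lift_definition zero_l2 :: l2 is "\<lambda>_. 0" by simp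

lift_definition plus_l2 :: "l2 \<Rightarrow> l2 \<Rightarrow> l2" is "\<lambda>x y n. x n + y n"
  by (rule summable_l2_add)

lift_definition scaleR_l2 :: "real \<Rightarrow> l2 \<Rightarrow> l2" is "\<lambda>r x n. complex_of_real r * x n"
  by (rule summable_l2_bounded_mult[where M = "\<bar>r\<bar>" for r]) auto

lift_definition uminus_l2 :: "l2 \<Rightarrow> l2" is "\<lambda>x n. - x n" by simp

definition minus_l2 :: "l2 \<Rightarrow> l2 \<Rightarrow> l2" where "minus_l2 x y = x + - y"

instance
proof
  fix x y z :: l2 and a b :: real
  show "x + y + z = x + (y + z)" "x + y = y + x" "0 + x = x" "- x + x = 0"
    by (transfer; simp add: algebra_simps)+
  show "x - y = x + - y" by (simp add: minus_l2_def)
  show "a *\<^sub>R (x + y) = a *\<^sub>R x + a *\<^sub>R y" "(a + b) *\<^sub>R x = a *\<^sub>R x + b *\<^sub>R x"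
    "a *\<^sub>R b *\<^sub>R x = (a * b) *\<^sub>R x" "1 *\<^sub>R x = x"
    by (transfer; simp add: algebra_simps)+
qed

end

instantiation l2 :: real_inner
begin

text \<open>The dot on the right is the inner product of the real plane, so this is the real part of
  the usual complex inner product.\<close>

lift_definition inner_l2 :: "l2 \<Rightarrow> l2 \<Rightarrow> real" is "\<lambda>x y. \<Sum>\<^sub>\<infinity>n. x n \<bullet> y n" .

definition norm_l2 :: "l2 \<Rightarrow> real" where "norm_l2 x = sqrt (x \<bullet> x)"

definition sgn_l2 :: "l2 \<Rightarrow> l2" where "sgn_l2 x = x /\<^sub>R norm x"

definition dist_l2 :: "l2 \<Rightarrow> l2 \<Rightarrow> real" where "dist_l2 x y = norm (x - y)"

definition uniformity_l2 :: "(l2 \<times> l2) filter" where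
  "uniformity_l2 = (INF e\<in>{0<..}. principal {(x, y). dist x y < e})"

definition open_l2 :: "l2 set \<Rightarrow> bool" where
  "open_l2 U = (\<forall>x\<in>U. \<forall>\<^sub>F (x', y) in uniformity. x' = x \<longrightarrow> y \<in> U)"

instance
proof
  fix x y z :: l2 and a :: real
  show "sgn x = x /\<^sub>R norm x" "dist x y = norm (x - y)" "norm x = sqrt (x \<bullet> x)"
    by (simp_all add: sgn_l2_def dist_l2_def norm_l2_def)
  show "(uniformity :: (l2 \<times> l2) filter) = (INF e\<in>{0<..}. principal {(x, y). dist x y < e})"
    by (rule uniformity_l2_def)
  show "open U = (\<forall>x\<in>U. \<forall>\<^sub>F (x', y) in uniformity. x' = x \<longrightarrow> y \<in> U)" for U :: "l2 set"
    by (rule open_l2_def)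
  show "x \<bullet> y = y \<bullet> x" by transfer (simp add: inner_commute)
  show "(x + y) \<bullet> z = x \<bullet> z + y \<bullet> z"
    by transfer (simp add: inner_add_left infsum_add summable_l2_inner)
  show "(a *\<^sub>R x) \<bullet> y = a * (x \<bullet> y)"
    by transfer
      (simp add: scaleR_conv_of_real[symmetric] infsum_cmult_right')
  show "0 \<le> x \<bullet> x" by transfer (simp add: infsum_nonneg)
  show "x \<bullet> x = 0 \<longleftrightarrow> x = 0"
  proof transfer
    fix x :: "nat \<Rightarrow> complex"
    assume "(\<lambda>n. (cmod (x n))\<^sup>2) summable_on UNIV"
    then have "cmod (x n) = 0" if "(\<Sum>\<^sub>\<infinity>n. (cmod (x n))\<^sup>2) = 0" for n
      using nonneg_infsum_le_0D[of "\<lambda>n. (cmod (x n))\<^sup>2" UNIV n] that by simp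
    then show "(\<Sum>\<^sub>\<infinity>n. x n \<bullet> x n) = 0 \<longleftrightarrow> x = (\<lambda>_. 0)"
      unfolding dot_square_norm by (metis (lifting) ext infsum_0 norm_eq_zero norm_zero zero_power2)
  qed
qed

end

lemma coord_zero [simp]: "coord 0 n = 0"
  and coord_add [simp]: "coord (x + y) n = coord x n + coord y n"
  and coord_uminus [simp]: "coord (- x) n = - coord x n"
  and coord_scaleR [simp]: "coord (r *\<^sub>R x) n = complex_of_real r * coord x n"
  by (transfer; simp)+

lemma coord_diff [simp]: "coord (x - y) n = coord x n - coord y n"
  by (simp only: diff_conv_add_uminus coord_add coord_uminus)

lemma l2_eqI: "(\<And>n. coord x n = coord y n) \<Longrightarrow> x = y"
  by transfer auto

lemma norm_l2_square: "(norm x)\<^sup>2 = (\<Sum>\<^sub>\<infinity>n. (cmod (coord x n))\<^sup>2)" for x :: l2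
  unfolding power2_norm_eq_inner by transfer (simp add: dot_square_norm)

lemma sum_coord_le_norm:
  assumes "finite F"
  shows "(\<Sum>n\<in>F. (cmod (coord x n))\<^sup>2) \<le> (norm x)\<^sup>2"
  unfolding norm_l2_square using coord[of x] assms by (intro finite_sum_le_infsum) auto

lemma norm_coord_le: "cmod (coord x n) \<le> norm x"
  using sum_coord_le_norm[of "{n}" x] by (auto intro: power2_le_imp_le[OF _ norm_ge_zero])

text \<open>Produces a vector together with a norm bound from estimates on finite partial sums
  alone. Completeness of the space and the bound for diagonal operators both rest on it.\<close>

lemma l2_of_bounded_sums:
  assumes "\<And>F. finite F \<Longrightarrow> (\<Sum>n\<in>F. (cmod (f n))\<^sup>2) \<le> B\<^sup>2" and "0 \<le> B"
  obtains x where "coord x = f" "norm x \<le> B"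
proof -
  have "(\<lambda>n. (cmod (f n))\<^sup>2) summable_on UNIV"
    using assms(1) by (intro nonneg_bdd_above_summable_on bdd_aboveI[of _ "B\<^sup>2"]) auto
  then have eq: "coord (Abs_l2 f) = f" by (simp add: Abs_l2_inverse)
  have "(norm (Abs_l2 f))\<^sup>2 \<le> B\<^sup>2"
    unfolding norm_l2_square eq using \<open>_ summable_on UNIV\<close> assms(1)
    by (intro infsum_le_finite_sums) auto
  then show thesis
    using that[OF eq] power2_le_imp_le[OF _ \<open>0 \<le> B\<close>] by blast
qed

section \<open>Completeness of the sequence space\<close>

instance l2 :: complete_space
proof
  fix u :: "nat \<Rightarrow> l2"
  assume u: "Cauchy u"
  \<comment> \<open>Each coordinate is dominated by the norm, so the sequence converges
    coordinatewise; the limit \<open>f\<close> is the candidate.\<close>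
  have "Cauchy (\<lambda>k. coord (u k) n)" for n
    unfolding Cauchy_def
  proof (intro allI impI)
    fix e :: real assume "0 < e"
    then obtain M where "\<forall>i\<ge>M. \<forall>j\<ge>M. dist (u i) (u j) < e"
      using u unfolding Cauchy_def by blast
    moreover have "dist (coord (u i) n) (coord (u j) n) \<le> dist (u i) (u j)" for i j
      using norm_coord_le[of "u i - u j" n] by (simp add: dist_norm)
    ultimately show "\<exists>M. \<forall>i\<ge>M. \<forall>j\<ge>M. dist (coord (u i) n) (coord (u j) n) < e"
      by (meson le_less_trans)
  qed
  then have "\<exists>l. (\<lambda>k. coord (u k) n) \<longlonglongrightarrow> l" for n
    by (simp add: Cauchy_convergent_iff convergent_def)
  then obtain f where f: "\<And>n. (\<lambda>k. coord (u k) n) \<longlonglongrightarrow> f n" by metis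
  \<comment> \<open>Membership of \<open>f\<close> in the space is still open, so closeness of
    \<open>u i\<close> to \<open>f\<close> is expressed by a vector \<open>d\<close> that has the
    coordinates of their difference. The limit is later recovered as \<open>u i - d\<close>.\<close>
  have close: "\<exists>M. \<forall>i\<ge>M. \<exists>d. coord d = (\<lambda>n. coord (u i) n - f n) \<and> norm d \<le> e" if "0 < e" for e
  proof -
    obtain M where M: "\<And>i j. i \<ge> M \<Longrightarrow> j \<ge> M \<Longrightarrow> dist (u i) (u j) < e"
      using u \<open>0 < e\<close> unfolding Cauchy_def by blast
    have "\<exists>d. coord d = (\<lambda>n. coord (u i) n - f n) \<and> norm d \<le> e" if "i \<ge> M" for i
    proof -
      have "(\<Sum>n\<in>F. (cmod (coord (u i) n - f n))\<^sup>2) \<le> e\<^sup>2" if "finite F" for F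
      \<comment> \<open>With \<open>F\<close> and \<open>i\<close> fixed, the Cauchy estimate for
        \<open>u i - u j\<close> passes to the limit in \<open>j\<close>, because only finitely many
        coordinates are involved.\<close>
      proof (rule tendsto_upperbound)
        show "((\<lambda>j. \<Sum>n\<in>F. (cmod (coord (u i) n - coord (u j) n))\<^sup>2)
            \<longlongrightarrow> (\<Sum>n\<in>F. (cmod (coord (u i) n - f n))\<^sup>2)) sequentially"
          by (intro tendsto_intros f)
        have "(\<Sum>n\<in>F. (cmod (coord (u i) n - coord (u j) n))\<^sup>2) \<le> e\<^sup>2" if "j \<ge> M" for j
        proof -
          have "(\<Sum>n\<in>F. (cmod (coord (u i - u j) n))\<^sup>2) \<le> (norm (u i - u j))\<^sup>2"
            by (rule sum_coord_le_norm[OF \<open>finite F\<close>])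
          also have "\<dots> \<le> e\<^sup>2"
            using M[OF \<open>i \<ge> M\<close> \<open>j \<ge> M\<close>] by (intro power_mono) (auto simp: dist_norm)
          finally show ?thesis by simp
        qed
        then show "\<forall>\<^sub>F j in sequentially. (\<Sum>n\<in>F. (cmod (coord (u i) n - coord (u j) n))\<^sup>2) \<le> e\<^sup>2"
          by (auto simp: eventually_sequentially)
      qed simp
      then obtain d where "coord d = (\<lambda>n. coord (u i) n - f n)" "norm d \<le> e"
        using l2_of_bounded_sums[of "\<lambda>n. coord (u i) n - f n" e] less_imp_le[OF \<open>0 < e\<close>] by blast
      then show ?thesis by blast
    qed
    then show ?thesis by blast
  qed
  obtain i d where d: "coord d = (\<lambda>n. coord (u i) n - f n)"
    using close[of 1] by auto
  have "u \<longlonglongrightarrow> u i - d"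
  proof (rule metric_LIMSEQ_I)
    fix r :: real assume "0 < r"
    then obtain M where M: "\<And>j. j \<ge> M \<Longrightarrow> \<exists>d. coord d = (\<lambda>n. coord (u j) n - f n) \<and> norm d \<le> r / 2"
      using close[of "r / 2"] by auto
    have "dist (u j) (u i - d) < r" if "j \<ge> M" for j
    proof -
      obtain d' where d': "coord d' = (\<lambda>n. coord (u j) n - f n)" "norm d' \<le> r / 2"
        using M[OF \<open>j \<ge> M\<close>] by blast
      have "d' = u j - (u i - d)"
        by (rule l2_eqI) (simp add: d' d)
      then show ?thesis using d' \<open>0 < r\<close> by (simp add: dist_norm)
    qed
    then show "\<exists>M. \<forall>j\<ge>M. dist (u j) (u i - d) < r" by blast
  qed
  then show "convergent u" by (auto simp: convergent_def)
qed

instance l2 :: banach ..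

definition unit_l2 :: "nat \<Rightarrow> l2" where
  "unit_l2 k = Abs_l2 (\<lambda>n. if n = k then 1 else 0)"

lemma coord_unit_l2: "coord (unit_l2 k) = (\<lambda>n. if n = k then 1 else 0)"
proof -
  have "(\<lambda>n. (cmod (if n = k then 1 else 0))\<^sup>2) summable_on UNIV \<longleftrightarrow>
      (\<lambda>n. (cmod (if n = k then 1 else 0))\<^sup>2) summable_on {k}"
    by (rule summable_on_cong_neutral) auto
  then show ?thesis
    unfolding unit_l2_def by (subst Abs_l2_inverse) auto
qed

lemma norm_unit_l2 [simp]: "norm (unit_l2 k) = 1"
proof -
  have "(norm (unit_l2 k))\<^sup>2 = (\<Sum>\<^sub>\<infinity>n\<in>{k}. (cmod (coord (unit_l2 k) n))\<^sup>2)"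
    unfolding norm_l2_square by (rule infsum_cong_neutral) (auto simp: coord_unit_l2)
  then have "(norm (unit_l2 k))\<^sup>2 = 1\<^sup>2" by (simp add: coord_unit_l2)
  then show ?thesis by (simp only: power2_eq_iff_nonneg norm_ge_zero zero_le_one)
qed

section \<open>Diagonal operators and the shift\<close>

text \<open>The default value 0 for an unbounded \<open>d\<close> makes this a bounded operator for
  every \<open>d\<close>, so \<open>ops_diag\<close> and \<open>adj_diag\<close> hold without a
  boundedness hypothesis.\<close>

lift_definition diag_fun :: "(nat \<Rightarrow> complex) \<Rightarrow> l2 \<Rightarrow> l2"
  is "\<lambda>d x n. if bounded (range d) then d n * x n else 0"
proof -
  fix d x :: "nat \<Rightarrow> complex"
  assume x: "(\<lambda>n. (cmod (x n))\<^sup>2) summable_on UNIV"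
  show "(\<lambda>n. (cmod (if bounded (range d) then d n * x n else 0))\<^sup>2) summable_on UNIV"
  proof (cases "bounded (range d)")
    case True
    then obtain M where "\<And>n. cmod (d n) \<le> M" by (auto simp: bounded_iff)
    then show ?thesis using summable_l2_bounded_mult[OF x, of d M] True by simp
  qed simp
qed

definition diag :: "(nat \<Rightarrow> complex) \<Rightarrow> l2 \<Rightarrow>\<^sub>L l2" where
  "diag d = Blinfun (diag_fun d)"

lemma norm_diag_fun_le:
  assumes "\<And>n. cmod (d n) \<le> M"
  shows "norm (diag_fun d x) \<le> norm x * M"
proof -
  have bd: "bounded (range d)" using assms by (auto simp: bounded_iff)
  have M: "0 \<le> M" using assms[of 0] norm_ge_zero order_trans by blast
  have "(\<Sum>n\<in>F. (cmod (d n * coord x n))\<^sup>2) \<le> (norm x * M)\<^sup>2" if "finite F" for F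
  proof -
    have "(\<Sum>n\<in>F. (cmod (d n * coord x n))\<^sup>2) \<le> (\<Sum>n\<in>F. M\<^sup>2 * (cmod (coord x n))\<^sup>2)"
      using assms by (intro sum_mono) (auto simp: norm_mult power_mult_distrib intro!: mult_right_mono power_mono)
    also have "\<dots> \<le> M\<^sup>2 * (norm x)\<^sup>2"
      using sum_coord_le_norm[OF that, of x] by (simp add: sum_distrib_left[symmetric] mult_left_mono)
    finally show ?thesis by (simp add: power_mult_distrib mult.commute)
  qed
  then obtain y where y: "coord y = (\<lambda>n. d n * coord x n)" "norm y \<le> norm x * M"
    using l2_of_bounded_sums[of "\<lambda>n. d n * coord x n" "norm x * M"]
      mult_nonneg_nonneg[OF norm_ge_zero M] by blast
  have "y = diag_fun d x"
    by (rule l2_eqI) (simp add: y diag_fun.rep_eq bd)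
  with y show ?thesis by simp
qed

lemma bounded_linear_diag_fun: "bounded_linear (diag_fun d)"
proof (cases "bounded (range d)")
  case True
  then obtain M where "\<And>n. cmod (d n) \<le> M" by (auto simp: bounded_iff)
  then show ?thesis
    using norm_diag_fun_le[of d M]
    by (intro bounded_linear_intro[of _ M])
      (auto intro!: l2_eqI simp: diag_fun.rep_eq algebra_simps)
next
  case False
  then have "diag_fun d = (\<lambda>x. 0)" by (auto intro!: l2_eqI simp: diag_fun.rep_eq)
  then show ?thesis by simp
qed

lemma coord_diag:
  "coord (diag d x) n = (if bounded (range d) then d n * coord x n else 0)"
  by (simp add: diag_def bounded_linear_Blinfun_apply bounded_linear_diag_fun diag_fun.rep_eq)

lemma norm_diag_le:
  assumes "\<And>n. cmod (d n) \<le> M"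
  shows "norm (diag d) \<le> M"
proof (rule norm_blinfun_bound)
  show "0 \<le> M" using assms[of 0] norm_ge_zero order_trans by blast
  show "norm (diag d x) \<le> M * norm x" for x
    using norm_diag_fun_le[OF assms, where x = x]
    by (simp add: diag_def bounded_linear_Blinfun_apply bounded_linear_diag_fun mult.commute)
qed

lemma diag_unit_l2: "bounded (range d) \<Longrightarrow> norm (diag d (unit_l2 n)) = cmod (d n)"
proof -
  assume bd: "bounded (range d)"
  have "(norm (diag d (unit_l2 n)))\<^sup>2 = (\<Sum>\<^sub>\<infinity>k\<in>{n}. (cmod (coord (diag d (unit_l2 n)) k))\<^sup>2)"
    unfolding norm_l2_square by (rule infsum_cong_neutral) (auto simp: coord_unit_l2 coord_diag)
  then show ?thesis by (simp add: coord_unit_l2 coord_diag bd)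
qed

text \<open>Obtained by testing on a basis vector. Together with \<open>norm_diag_le\<close> it
  identifies the norm of \<open>diag d\<close> as the supremum of the moduli of the entries.\<close>

lemma norm_le_norm_diag: "bounded (range d) \<Longrightarrow> cmod (d n) \<le> norm (diag d)"
  using norm_blinfun[of "diag d" "unit_l2 n"] by (simp add: diag_unit_l2)

lemma inner_l2_eq: "x \<bullet> y = (\<Sum>\<^sub>\<infinity>n. coord x n \<bullet> coord y n)"
  by transfer simp

lemma inner_diag: "diag (\<lambda>n. cnj (d n)) x \<bullet> y = x \<bullet> diag d y"
proof -
  have "bounded (range (\<lambda>n. cnj (d n))) \<longleftrightarrow> bounded (range d)"
    by (simp add: bounded_iff)
  then show ?thesis
    unfolding inner_l2_eq coord_diag
    by (auto intro!: infsum_cong simp: inner_complex_def algebra_simps)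
qed

lemma bounded_range_mult:
  fixes d e :: "nat \<Rightarrow> complex"
  assumes "bounded (range d)" "bounded (range e)"
  shows "bounded (range (\<lambda>n. d n * e n))"
proof -
  obtain M N where "\<And>n. cmod (d n) \<le> M" "\<And>n. cmod (e n) \<le> N"
    using assms by (auto simp: bounded_iff)
  then have "cmod (d n * e n) \<le> M * N" for n
    unfolding norm_mult by (intro mult_mono) (auto intro: order_trans[OF norm_ge_zero])
  then show ?thesis by (auto simp: bounded_iff)
qed

lemma bounded_range_add:
  fixes d e :: "nat \<Rightarrow> complex"
  assumes "bounded (range d)" "bounded (range e)"
  shows "bounded (range (\<lambda>n. d n + e n))"
  using assms by (rule bounded_plus_comp)

lemma diag_mult:
  assumes "bounded (range d)" "bounded (range e)"
  shows "diag d o\<^sub>L diag e = diag (\<lambda>n. d n * e n)"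
  using assms bounded_range_mult[OF assms]
  by (intro blinfun_eqI l2_eqI) (simp add: coord_diag)

lemma diag_add:
  assumes "bounded (range d)" "bounded (range e)"
  shows "diag d + diag e = diag (\<lambda>n. d n + e n)"
  using assms bounded_range_add[OF assms]
  by (intro blinfun_eqI l2_eqI) (simp add: coord_diag blinfun.add_left algebra_simps)

lemma diag_one: "diag (\<lambda>n. 1) = id_blinfun"
  by (intro blinfun_eqI l2_eqI) (simp add: coord_diag)

section \<open>The isometric shift and its adjoint\<close>

lift_definition shift_fun :: "l2 \<Rightarrow> l2" is "\<lambda>x m. if odd m then x (m div 2) else 0"
proof -
  fix x :: "nat \<Rightarrow> complex"
  assume "(\<lambda>n. (cmod (x n))\<^sup>2) summable_on UNIV"
  then have "(\<lambda>m. (cmod (x (m div 2)))\<^sup>2) summable_on range (\<lambda>n. 2 * n + 1)"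
    by (subst summable_on_reindex) (auto simp: inj_on_def o_def)
  moreover have "m \<in> range (\<lambda>n. 2 * n + 1) \<longleftrightarrow> odd m" for m :: nat
    by (auto elim!: oddE)
  ultimately show "(\<lambda>m. (cmod (if odd m then x (m div 2) else 0))\<^sup>2) summable_on UNIV"
    by (subst summable_on_cong_neutral[where T = "range (\<lambda>n. 2 * n + 1)"]) auto
qed

lift_definition unshift_fun :: "l2 \<Rightarrow> l2" is "\<lambda>x n. x (2 * n + 1)"
proof -
  fix x :: "nat \<Rightarrow> complex"
  assume "(\<lambda>n. (cmod (x n))\<^sup>2) summable_on UNIV"
  then have "(\<lambda>n. (cmod (x n))\<^sup>2) summable_on range (\<lambda>n. 2 * n + 1)"
    by (rule summable_on_subset) auto
  then show "(\<lambda>n. (cmod (x (2 * n + 1)))\<^sup>2) summable_on UNIV"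
    by (subst (asm) summable_on_reindex) (auto simp: inj_on_def o_def)
qed

lemma inner_shift_fun: "shift_fun x \<bullet> y = x \<bullet> unshift_fun y"
proof -
  have "shift_fun x \<bullet> y = (\<Sum>\<^sub>\<infinity>m\<in>range (\<lambda>n. 2 * n + 1). coord (shift_fun x) m \<bullet> coord y m)"
    unfolding inner_l2_eq
    by (rule infsum_cong_neutral) (auto simp: shift_fun.rep_eq image_iff elim: oddE)
  also have "\<dots> = x \<bullet> unshift_fun y"
    unfolding inner_l2_eq
    by (subst infsum_reindex) (auto simp: inj_on_def o_def shift_fun.rep_eq unshift_fun.rep_eq)
  finally show ?thesis .
qed

lemma unshift_shift_fun: "unshift_fun (shift_fun x) = x"
  by (rule l2_eqI) (simp add: shift_fun.rep_eq unshift_fun.rep_eq)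

lemma norm_shift_fun: "norm (shift_fun x) = norm x"
  by (simp add: norm_eq_sqrt_inner inner_shift_fun unshift_shift_fun)

text \<open>With \<open>S\<close> the shift and \<open>U\<close> its adjoint, the square of the norm
  of \<open>U x\<close> is the inner product of \<open>S (U x)\<close> with \<open>x\<close>.
  Cauchy-Schwarz and the isometry of \<open>S\<close> then give the bound.\<close>

lemma norm_unshift_fun: "norm (unshift_fun x) \<le> norm x"
proof -
  have "norm (unshift_fun x) * norm (unshift_fun x) = shift_fun (unshift_fun x) \<bullet> x"
    by (simp add: inner_shift_fun flip: power2_eq_square power2_norm_eq_inner)
  also have "\<dots> \<le> norm (unshift_fun x) * norm x"
    using norm_cauchy_schwarz[of "shift_fun (unshift_fun x)" x] by (simp add: norm_shift_fun)
  finally show ?thesis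
    by (cases "norm (unshift_fun x) = 0") (auto simp: mult_le_cancel_left)
qed

definition shift :: "l2 \<Rightarrow>\<^sub>L l2" where "shift = Blinfun shift_fun"

definition unshift :: "l2 \<Rightarrow>\<^sub>L l2" where "unshift = Blinfun unshift_fun"

lemma shift_apply: "shift x = shift_fun x"
proof -
  have "bounded_linear shift_fun"
    by (rule bounded_linear_intro[of _ 1])
      (auto intro!: l2_eqI simp: shift_fun.rep_eq norm_shift_fun)
  then show ?thesis by (simp add: shift_def bounded_linear_Blinfun_apply)
qed

lemma unshift_apply: "unshift x = unshift_fun x"
proof -
  have "bounded_linear unshift_fun"
    by (rule bounded_linear_intro[of _ 1])
      (auto intro!: l2_eqI simp: unshift_fun.rep_eq norm_unshift_fun)
  then show ?thesis by (simp add: unshift_def bounded_linear_Blinfun_apply)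
qed

lemma inner_unshift: "unshift x \<bullet> y = x \<bullet> shift y"
  by (metis inner_commute inner_shift_fun shift_apply unshift_apply)

lemma coord_shift: "coord (shift x) m = (if odd m then coord x (m div 2) else 0)"
  and coord_unshift: "coord (unshift x) n = coord x (2 * n + 1)"
  by (simp_all add: shift_apply unshift_apply shift_fun.rep_eq unshift_fun.rep_eq)

section \<open>A C*-algebra of operators\<close>

text \<open>The space of bounded operators is only a real vector space here; a complex scalar acts
  as the constant diagonal operator.\<close>

definition scale_op :: "complex \<Rightarrow> (l2 \<Rightarrow>\<^sub>L l2) \<Rightarrow> l2 \<Rightarrow>\<^sub>L l2" where
  "scale_op c T = diag (\<lambda>_. c) o\<^sub>L T"

text \<open>
  As \<open>l2\<close> is only a real inner product space, the complex linearity of \<open>T\<close> is expressed by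
  commutation with scalars. An adjoint for the real inner product is then also the complex one.
  Including its existence in the definition avoids the Riesz representation theorem.
\<close>

definition ops :: "(l2 \<Rightarrow>\<^sub>L l2) set" where
  "ops = {T. (\<forall>c. diag (\<lambda>_. c) o\<^sub>L T = T o\<^sub>L diag (\<lambda>_. c)) \<and>
     (\<exists>S :: l2 \<Rightarrow>\<^sub>L l2. \<forall>x y. S x \<bullet> y = x \<bullet> T y)}"

definition adj :: "(l2 \<Rightarrow>\<^sub>L l2) \<Rightarrow> l2 \<Rightarrow>\<^sub>L l2" where
  "adj T = (THE S :: l2 \<Rightarrow>\<^sub>L l2. \<forall>x y. S x \<bullet> y = x \<bullet> T y)"

text \<open>A vector is determined by its inner products with all vectors, so there is at most one
  adjoint and the description in \<open>adj\<close> picks it.\<close>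

lemma adj_eqI:
  fixes S T :: "l2 \<Rightarrow>\<^sub>L l2"
  assumes "\<And>x y. S x \<bullet> y = x \<bullet> T y"
  shows "adj T = S"
  unfolding adj_def
proof (rule the_equality)
  fix S' :: "l2 \<Rightarrow>\<^sub>L l2"
  assume "\<forall>x y. S' x \<bullet> y = x \<bullet> T y"
  then have "\<forall>y. S' x \<bullet> y = S x \<bullet> y" for x using assms by simp
  then show "S' = S" by (intro blinfun_eqI) (simp add: vector_eq_rdot)
qed (use assms in blast)

lemma inner_adj: "T \<in> ops \<Longrightarrow> adj T x \<bullet> y = x \<bullet> T y"
  using adj_eqI[of _ T] unfolding ops_def by blast

lemma ops_scalar:
  assumes "T \<in> ops"
  shows "T (diag (\<lambda>_. c) x) = diag (\<lambda>_. c) (T x)"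
proof -
  have "diag (\<lambda>_. c) o\<^sub>L T = T o\<^sub>L diag (\<lambda>_. c)" using assms by (simp add: ops_def)
  then show ?thesis by (metis blinfun_apply_blinfun_compose)
qed

lemma opsI:
  fixes S T :: "l2 \<Rightarrow>\<^sub>L l2"
  assumes "\<And>c x. T (diag (\<lambda>_. c) x) = diag (\<lambda>_. c) (T x)" "\<And>x y. S x \<bullet> y = x \<bullet> T y"
  shows "T \<in> ops"
  unfolding ops_def using assms by (auto intro!: blinfun_eqI)

lemma inner_scalar: "diag (\<lambda>_. c) x \<bullet> y = x \<bullet> diag (\<lambda>_. cnj c) y"
  using inner_diag[of "\<lambda>_. cnj c" x y] by simp

lemma norm_scalar: "norm (diag (\<lambda>_. c) x) = cmod c * norm x"
proof -
  have "(norm (diag (\<lambda>_. c) x))\<^sup>2 = (cmod c * norm x)\<^sup>2"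
    unfolding norm_l2_square power_mult_distrib
    by (simp add: coord_diag norm_mult power_mult_distrib infsum_cmult_right')
  then show ?thesis by (simp only: power2_eq_iff_nonneg norm_ge_zero mult_nonneg_nonneg)
qed

lemma norm_scale_op: "norm (scale_op c T) = cmod c * norm T"
proof (rule antisym)
  show "norm (scale_op c T) \<le> cmod c * norm T"
    unfolding scale_op_def
    by (rule norm_blinfun_bound)
      (auto simp: norm_scalar mult.assoc intro!: mult_left_mono norm_blinfun)
  show "cmod c * norm T \<le> norm (scale_op c T)"
  proof (cases "c = 0")
    case False
    have "norm T \<le> norm (scale_op c T) / cmod c"
    proof (rule norm_blinfun_bound)
      fix x
      have "cmod c * norm (T x) \<le> norm (scale_op c T) * norm x"
        using norm_blinfun[of "scale_op c T" x] by (simp add: scale_op_def norm_scalar)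
      then show "norm (T x) \<le> norm (scale_op c T) / cmod c * norm x"
        using False by (simp add: field_simps)
    qed simp
    then show ?thesis using False by (simp add: field_simps)
  qed simp
qed

lemma ops_zero: "0 \<in> ops"
  by (rule opsI[of _ 0]) auto

lemma ops_add: "S \<in> ops \<Longrightarrow> T \<in> ops \<Longrightarrow> S + T \<in> ops"
  by (rule opsI[of _ "adj S + adj T"])
    (auto simp: blinfun.add_left blinfun.add_right ops_scalar inner_add inner_adj)

lemma adj_add: "S \<in> ops \<Longrightarrow> T \<in> ops \<Longrightarrow> adj (S + T) = adj S + adj T"
  by (rule adj_eqI) (auto simp: blinfun.add_left inner_add inner_adj)

lemma ops_compose: "S \<in> ops \<Longrightarrow> T \<in> ops \<Longrightarrow> S o\<^sub>L T \<in> ops"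
  by (rule opsI[of _ "adj T o\<^sub>L adj S"]) (auto simp: ops_scalar inner_adj)

lemma adj_compose: "S \<in> ops \<Longrightarrow> T \<in> ops \<Longrightarrow> adj (S o\<^sub>L T) = adj T o\<^sub>L adj S"
  by (rule adj_eqI) (auto simp: inner_adj)

lemma ops_diag: "diag d \<in> ops"
  by (rule opsI[of _ "diag (\<lambda>n. cnj (d n))"])
    (auto intro!: l2_eqI simp: coord_diag inner_diag)

lemma adj_diag: "adj (diag d) = diag (\<lambda>n. cnj (d n))"
  by (rule adj_eqI) (rule inner_diag)

lemma ops_scale: "T \<in> ops \<Longrightarrow> scale_op c T \<in> ops"
  unfolding scale_op_def by (intro ops_compose ops_diag)

lemma adj_scale: "T \<in> ops \<Longrightarrow> adj (scale_op c T) = scale_op (cnj c) (adj T)"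
  by (rule adj_eqI)
    (simp add: scale_op_def inner_scalar inner_adj ops_scalar)

lemma adj_in_ops: "T \<in> ops \<Longrightarrow> adj T \<in> ops"
proof (rule opsI[of _ T])
  assume T: "T \<in> ops"
  fix c x
  have "adj T (diag (\<lambda>_. c) x) \<bullet> y = diag (\<lambda>_. c) (adj T x) \<bullet> y" for y
    by (simp add: inner_adj inner_scalar ops_scalar T)
  then show "adj T (diag (\<lambda>_. c) x) = diag (\<lambda>_. c) (adj T x)"
    using vector_eq_rdot by blast
next
  assume "T \<in> ops"
  then show "T x \<bullet> y = x \<bullet> adj T y" for x y
    by (metis inner_adj inner_commute)
qed

lemma adj_adj: "T \<in> ops \<Longrightarrow> adj (adj T) = T"
  by (rule adj_eqI) (metis inner_adj inner_commute)

lemma ops_shift: "shift \<in> ops"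
  by (rule opsI[of _ unshift]) (auto intro!: l2_eqI simp: coord_diag coord_shift inner_unshift)

lemma adj_shift: "adj shift = unshift"
  by (rule adj_eqI) (rule inner_unshift)

text \<open>The lower bound comes from writing the square of the norm of \<open>T x\<close> as the
  inner product of \<open>adj T (T x)\<close> with \<open>x\<close>. The upper bound is
  submultiplicativity once \<open>norm (adj T) \<le> norm T\<close> is known.\<close>

lemma norm_adj_compose:
  assumes "T \<in> ops"
  shows "norm (adj T o\<^sub>L T) = (norm T)\<^sup>2"
proof (rule antisym)
  have sq: "(norm (T x))\<^sup>2 \<le> norm (adj T o\<^sub>L T) * (norm x)\<^sup>2" if "T \<in> ops" for T x
  proof -
    have "(norm (T x))\<^sup>2 = (adj T o\<^sub>L T) x \<bullet> x"
      using that by (simp add: power2_norm_eq_inner inner_adj)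
    also have "\<dots> \<le> norm ((adj T o\<^sub>L T) x) * norm x"
      by (rule norm_cauchy_schwarz)
    also have "\<dots> \<le> norm (adj T o\<^sub>L T) * norm x * norm x"
      by (intro mult_right_mono norm_blinfun) simp
    finally show ?thesis by (simp add: power2_eq_square mult.assoc)
  qed
  have lower: "(norm T)\<^sup>2 \<le> norm (adj T o\<^sub>L T)" if "T \<in> ops" for T
  proof -
    have "norm T \<le> sqrt (norm (adj T o\<^sub>L T))"
    proof (rule norm_blinfun_bound)
      show "norm (T x) \<le> sqrt (norm (adj T o\<^sub>L T)) * norm x" for x
        using real_sqrt_le_mono[OF sq[OF that, of x]] by (simp add: real_sqrt_mult)
    qed simp
    then show ?thesis
      using power_mono[of "norm T" "sqrt (norm (adj T o\<^sub>L T))" 2] by simp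
  qed
  then show "(norm T)\<^sup>2 \<le> norm (adj T o\<^sub>L T)" using assms .
  \<comment> \<open>The lower bound and submultiplicativity give this after cancelling
    \<open>norm T\<close>; applied to \<open>adj T\<close> it yields the reverse inequality.\<close>
  have le: "norm T \<le> norm (adj T)" if "T \<in> ops" for T
  proof -
    have "norm T * norm T \<le> norm (adj T) * norm T"
      using lower[OF that] norm_blinfun_compose[of "adj T" T] by (simp add: power2_eq_square)
    then show ?thesis by (cases "norm T = 0") (auto simp: mult_le_cancel_right)
  qed
  have "norm (adj T) \<le> norm T"
    using le[OF adj_in_ops[OF assms]] by (simp add: adj_adj assms)
  then show "norm (adj T o\<^sub>L T) \<le> (norm T)\<^sup>2"
    using norm_blinfun_compose[of "adj T" T] mult_right_mono[of "norm (adj T)" "norm T" "norm T"]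
    by (simp add: power2_eq_square)
qed

lemma norm_adj_le:
  assumes "T \<in> ops"
  shows "norm (adj T) \<le> norm T"
proof -
  have "norm (adj T) * norm (adj T) = norm (T o\<^sub>L adj T)"
    using norm_adj_compose[OF adj_in_ops[OF assms]] by (simp add: adj_adj assms power2_eq_square)
  also have "\<dots> \<le> norm T * norm (adj T)" by (rule norm_blinfun_compose)
  finally show ?thesis by (cases "norm (adj T) = 0") (auto simp: mult_le_cancel_right)
qed

lemma ops_diff: "S \<in> ops \<Longrightarrow> T \<in> ops \<Longrightarrow> S - T \<in> ops"
  by (rule opsI[of _ "adj S - adj T"])
    (auto simp: blinfun.diff_left blinfun.diff_right ops_scalar inner_diff inner_adj)

lemma adj_diff: "S \<in> ops \<Longrightarrow> T \<in> ops \<Longrightarrow> adj (S - T) = adj S - adj T"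
  by (rule adj_eqI) (auto simp: blinfun.diff_left inner_diff inner_adj)

text \<open>Since \<open>adj\<close> does not increase norms, the adjoints of a convergent sequence
  form a Cauchy sequence. Their limit serves as adjoint of the limit operator, and commutation with
  scalars passes to the limit pointwise.\<close>

lemma closed_ops: "closed ops"
  unfolding closed_sequential_limits
proof (intro allI impI, elim conjE)
  fix u T
  assume u: "\<forall>n. u n \<in> ops" and lim: "u \<longlonglongrightarrow> T"
  have "Cauchy (\<lambda>n. adj (u n))"
    unfolding Cauchy_def
  proof (intro allI impI)
    fix e :: real assume "0 < e"
    then obtain M where "\<forall>m\<ge>M. \<forall>n\<ge>M. dist (u m) (u n) < e"
      using LIMSEQ_imp_Cauchy[OF lim] unfolding Cauchy_def by blast
    moreover have "dist (adj (u m)) (adj (u n)) \<le> dist (u m) (u n)" for m n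
      using u norm_adj_le[of "u m - u n"] by (simp add: dist_norm adj_diff ops_diff)
    ultimately show "\<exists>M. \<forall>m\<ge>M. \<forall>n\<ge>M. dist (adj (u m)) (adj (u n)) < e"
      by (meson le_less_trans)
  qed
  then obtain S where S: "(\<lambda>n. adj (u n)) \<longlonglongrightarrow> S"
    by (auto simp: Cauchy_convergent_iff convergent_def)
  show "T \<in> ops"
  proof (rule opsI[of _ S])
    fix c x
    have "(\<lambda>n. u n (diag (\<lambda>_. c) x)) \<longlonglongrightarrow> T (diag (\<lambda>_. c) x)"
      by (intro tendsto_intros lim)
    moreover have "(\<lambda>n. diag (\<lambda>_. c) (u n x)) \<longlonglongrightarrow> diag (\<lambda>_. c) (T x)"
      by (intro tendsto_intros lim)
    ultimately show "T (diag (\<lambda>_. c) x) = diag (\<lambda>_. c) (T x)"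
      using u by (simp add: ops_scalar LIMSEQ_unique)
  next
    fix x y
    have "(\<lambda>n. adj (u n) x \<bullet> y) \<longlonglongrightarrow> S x \<bullet> y" "(\<lambda>n. x \<bullet> u n y) \<longlonglongrightarrow> x \<bullet> T y"
      by (intro tendsto_intros lim S)+
    then show "S x \<bullet> y = x \<bullet> T y"
      using u by (simp add: inner_adj LIMSEQ_unique)
  qed
qed

section \<open>Transport of the operators to the element type of the statement\<close>

definition op_rep :: "(l2 \<Rightarrow>\<^sub>L l2) \<Rightarrow> seq_operator" where
  "op_rep T f = coord (T (Abs_l2 f))"

text \<open>Arguments of the form \<open>coord x\<close> suffice to recover the operator. On a
  sequence that is not square-summable, \<open>Abs_l2\<close> gives an unspecified vector, which
  does no harm.\<close>

lemma inj_op_rep: "inj op_rep"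
proof (rule injI, rule blinfun_eqI)
  fix S T :: "l2 \<Rightarrow>\<^sub>L l2" and x
  assume "op_rep S = op_rep T"
  then have "op_rep S (coord x) = op_rep T (coord x)" by simp
  then show "S x = T x" by (simp add: op_rep_def coord_inverse coord_inject)
qed

lemma op_rep_eq_iff [simp]: "op_rep S = op_rep T \<longleftrightarrow> S = T"
  using inj_op_rep by (simp add: inj_eq)

lemma inv_op_rep [simp]: "inv op_rep (op_rep T) = T"
  using inj_op_rep by simp

definition op_algebra :: "seq_operator cstar" where
  "op_algebra = \<lparr>
     elems = op_rep ` ops,
     azero = op_rep 0,
     aadd = (\<lambda>f g. op_rep (inv op_rep f + inv op_rep g)),
     ascale = (\<lambda>c f. op_rep (scale_op c (inv op_rep f))),
     amult = (\<lambda>f g. op_rep (inv op_rep f o\<^sub>L inv op_rep g)),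
     astar = (\<lambda>f. op_rep (adj (inv op_rep f))),
     anorm = (\<lambda>f. norm (inv op_rep f))\<rparr>"

lemma op_algebra_simps [simp]:
  "elems op_algebra = op_rep ` ops"
  "azero op_algebra = op_rep 0"
  "aadd op_algebra (op_rep S) (op_rep T) = op_rep (S + T)"
  "ascale op_algebra c (op_rep T) = op_rep (scale_op c T)"
  "amult op_algebra (op_rep S) (op_rep T) = op_rep (S o\<^sub>L T)"
  "astar op_algebra (op_rep T) = op_rep (adj T)"
  "anorm op_algebra (op_rep T) = norm T"
  by (simp_all add: op_algebra_def)

lemma op_rep_in_elems: "op_rep T \<in> op_rep ` ops \<longleftrightarrow> T \<in> ops"
  by (auto simp: image_iff)

lemma scale_op_minus_one: "scale_op (- 1) T = - T"
  by (intro blinfun_eqI l2_eqI) (simp add: scale_op_def coord_diag blinfun.minus_left)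

lemma aminus_op_algebra: "aminus op_algebra f g = op_rep (inv op_rep f - inv op_rep g)"
  by (simp add: aminus_def op_algebra_def scale_op_minus_one)

lemma aminus_op_rep [simp]: "aminus op_algebra (op_rep S) (op_rep T) = op_rep (S - T)"
  by (simp add: aminus_op_algebra)

text \<open>The metric is the operator norm distance read through \<open>inv op_rep\<close>, so this
  is completeness of a closed subset of a Banach space.\<close>

lemma mcomplete_op_algebra:
  "Metric_space.mcomplete (elems op_algebra) (\<lambda>x y. anorm op_algebra (aminus op_algebra x y))"
proof -
  define d where "d x y = anorm op_algebra (aminus op_algebra x y)" for x y
  have d: "d x y = dist (inv op_rep x) (inv op_rep y)" for x y
    by (simp add: d_def aminus_op_algebra dist_norm)
  interpret M: Metric_space "op_rep ` ops" d
    by unfold_locales (auto simp: d dist_commute dist_triangle)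
  have "M.mcomplete"
    unfolding M.mcomplete_def
  proof (intro allI impI)
    fix u assume "M.MCauchy u"
    then have u: "range u \<subseteq> op_rep ` ops"
      and C: "\<forall>e>0. \<exists>N. \<forall>m n. N \<le> m \<longrightarrow> N \<le> n \<longrightarrow> d (u m) (u n) < e"
      by (auto simp: M.MCauchy_def)
    have "Cauchy (\<lambda>n. inv op_rep (u n))"
      using C unfolding Cauchy_def d by blast
    then obtain T where T: "(\<lambda>n. inv op_rep (u n)) \<longlonglongrightarrow> T"
      by (auto simp: Cauchy_convergent_iff convergent_def)
    have "inv op_rep (u n) \<in> ops" for n
    proof -
      have "u n \<in> op_rep ` ops" using u by blast
      then show ?thesis by auto
    qed
    then have "T \<in> ops" using closed_sequentially[OF closed_ops _ T] by blast
    moreover have "\<exists>N. \<forall>n\<ge>N. u n \<in> op_rep ` ops \<and> d (u n) (op_rep T) < e" if "0 < e" for e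
      using metric_LIMSEQ_D[OF T that] range_subsetD[OF u] unfolding d inv_op_rep by blast
    ultimately show "\<exists>x. limitin M.mtopology u x sequentially"
      by (auto simp: M.limit_metric_sequentially intro!: exI[of _ "op_rep T"])
  qed
  then show ?thesis by (simp add: d_def[abs_def])
qed

lemma scale_op_add: "scale_op c (S + T) = scale_op c S + scale_op c T"
  and scale_op_add_left: "scale_op (c + c') T = scale_op c T + scale_op c' T"
  and scale_op_scale_op: "scale_op c (scale_op c' T) = scale_op (c * c') T"
  and scale_op_one: "scale_op 1 T = T"
  and scale_op_compose: "scale_op c S o\<^sub>L T = scale_op c (S o\<^sub>L T)"
  by (intro blinfun_eqI l2_eqI;
      simp add: scale_op_def coord_diag blinfun.add_left blinfun.add_right algebra_simps)+

text \<open>Complex linearity of \<open>S\<close>, in the form of commutation with constant diagonal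
  operators, lets the scalar move to the front.\<close>

lemma compose_scale_op: "S \<in> ops \<Longrightarrow> S o\<^sub>L scale_op c T = scale_op c (S o\<^sub>L T)"
  by (intro blinfun_eqI) (simp add: scale_op_def ops_scalar)

lemma cstar_op_algebra: "cstar_algebra op_algebra"
proof (unfold_locales, goal_cases)
  \<comment> \<open>Goal 28 is the completeness axiom; the others are algebraic identities, closure
    properties and norm estimates proved above.\<close>
  case 28
  show ?case by (rule mcomplete_op_algebra)
qed (auto simp: op_rep_in_elems ops_zero ops_add ops_scale ops_compose adj_in_ops
    scale_op_add scale_op_add_left scale_op_scale_op scale_op_one scale_op_compose compose_scale_op
    scale_op_minus_one adj_add adj_scale adj_compose adj_adj norm_adj_compose norm_scale_op
    norm_triangle_ineq norm_blinfun_compose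
    blinfun.add_left blinfun.add_right intro!: blinfun_eqI)

section \<open>Spectrum and functional calculus of diagonal operators\<close>

lemma ops_id: "id_blinfun \<in> ops"
  using ops_diag[of "\<lambda>_. 1"] by (simp add: diag_one)

lemma is_unit_op_algebra: "is_unit_of op_algebra (op_rep id_blinfun)"
  by (auto simp: is_unit_of_def op_rep_in_elems ops_id intro: blinfun_eqI)

lemma aunit_op_algebra: "aunit op_algebra = op_rep id_blinfun"
  unfolding aunit_def
proof (rule the_equality, rule is_unit_op_algebra)
  fix e assume "is_unit_of op_algebra e"
  then show "e = op_rep id_blinfun"
    using is_unit_op_algebra unfolding is_unit_of_def by metis
qed

lemma scale_op_id: "scale_op c id_blinfun = diag (\<lambda>_. c)"
  by (intro blinfun_eqI) (simp add: scale_op_def)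

text \<open>The algebra has a unit, so the spectrum is taken in the algebra itself and not in its
  unitization.\<close>

lemma spectrum_op_algebra:
  assumes "T \<in> ops"
  shows "spectrum op_algebra (op_rep T) =
    {c. \<not> (\<exists>S\<in>ops. (T - diag (\<lambda>_. c)) o\<^sub>L S = id_blinfun \<and>
                   S o\<^sub>L (T - diag (\<lambda>_. c)) = id_blinfun)}"
proof -
  have "unital op_algebra" using is_unit_op_algebra by (auto simp: unital_def)
  moreover have "T - diag (\<lambda>_. c) \<in> ops" for c by (intro ops_diff ops_diag assms)
  ultimately show ?thesis
    by (simp add: spectrum_def unital_spectrum_def ainvertible_def aunit_op_algebra scale_op_id
        op_rep_in_elems)
qed

lemma diag_minus_scalar:
  "bounded (range d) \<Longrightarrow> diag d - diag (\<lambda>_. c) = diag (\<lambda>n. d n - c)"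
  using bounded_range_add[of d "\<lambda>_. - c"]
  by (intro blinfun_eqI l2_eqI) (simp add: coord_diag blinfun.diff_left algebra_simps)

text \<open>A point at positive distance from all entries gives bounded reciprocals, hence a
  diagonal inverse. At a point of the closure, some basis vectors are shrunk arbitrarily, which
  excludes a bounded left inverse.\<close>

lemma spectrum_diag:
  assumes bd: "bounded (range d)"
  shows "spectrum op_algebra (op_rep (diag d)) = closure (range d)"
proof -
  have bdc: "bounded (range (\<lambda>n. d n - c))" for c
    using bounded_range_add[OF bd, of "\<lambda>_. - c"] by simp
  have "(\<exists>S\<in>ops. diag (\<lambda>n. d n - c) o\<^sub>L S = id_blinfun \<and> S o\<^sub>L diag (\<lambda>n. d n - c) = id_blinfun)
    \<longleftrightarrow> c \<notin> closure (range d)" (is "?inv \<longleftrightarrow> _") for c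
  proof
    assume "c \<notin> closure (range d)"
    then obtain e where "0 < e" and e: "\<And>n. e \<le> dist (d n) c"
      unfolding closure_approachable by (auto simp: not_less)
    have nz: "d n \<noteq> c" for n using e[of n] \<open>0 < e\<close> by auto
    have "cmod (inverse (d n - c)) \<le> inverse e" for n
      using le_imp_inverse_le[OF e[of n] \<open>0 < e\<close>] by (simp add: norm_inverse dist_norm)
    then have "bounded (range (\<lambda>n. inverse (d n - c)))" by (auto simp: bounded_iff)
    then have "diag (\<lambda>n. d n - c) o\<^sub>L diag (\<lambda>n. inverse (d n - c)) = id_blinfun \<and>
        diag (\<lambda>n. inverse (d n - c)) o\<^sub>L diag (\<lambda>n. d n - c) = id_blinfun"
      by (simp add: diag_mult bdc nz diag_one)
    then show ?inv using ops_diag by blast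
  next
    assume ?inv
    then obtain S where S: "S o\<^sub>L diag (\<lambda>n. d n - c) = id_blinfun" by blast
    show "c \<notin> closure (range d)"
    proof
      assume "c \<in> closure (range d)"
      \<comment> \<open>A left inverse \<open>S\<close> forces
        \<open>1 \<le> norm S * cmod (d n - c)\<close> for every \<open>n\<close>. The summand 1
        keeps the threshold defined when \<open>S\<close> is zero and makes it small enough to
        contradict this.\<close>
      moreover have "0 < inverse (norm S + 1)" by (simp add: add_nonneg_pos)
      ultimately obtain n where n: "dist (d n) c < inverse (norm S + 1)"
        unfolding closure_approachable by blast
      have "unit_l2 n = S (diag (\<lambda>n. d n - c) (unit_l2 n))"
        using S by (metis blinfun_apply_blinfun_compose blinfun_apply_id_blinfun id_apply)
      then have "1 \<le> norm S * cmod (d n - c)"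
        using norm_blinfun[of S "diag (\<lambda>n. d n - c) (unit_l2 n)"] by (simp add: diag_unit_l2 bdc)
      also have "\<dots> \<le> (norm S + 1) * cmod (d n - c)" by (simp add: mult_right_mono)
      also have "\<dots> < (norm S + 1) * inverse (norm S + 1)"
        using n by (intro mult_strict_left_mono) (auto simp: dist_norm add_nonneg_pos)
      also have "\<dots> = 1"
        by (rule right_inverse) (metis add_nonneg_pos less_irrefl norm_ge_zero zero_less_one)
      finally show False by simp
    qed
  qed
  then show ?thesis
    by (simp add: spectrum_op_algebra ops_diag diag_minus_scalar bd)
qed

lemma bounded_range_calculus:
  assumes "bounded (range d)" "f \<in> calculus_functions op_algebra (op_rep (diag d))"
  shows "bounded (range (\<lambda>n. f (d n)))"
proof -
  have "continuous_on (closure (range d)) f"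
    using assms by (simp add: calculus_functions_def spectrum_diag)
  then have "bounded (f ` closure (range d))"
    using assms(1) by (intro compact_imp_bounded compact_continuous_image) auto
  then show ?thesis
    by (rule bounded_subset) (auto intro!: imageI closure_subset[THEN subsetD])
qed

text \<open>By continuity of \<open>f\<close>, the bound by the operator norm extends from the
  entries to their closure, so the supremum over the spectrum is already that over the
  entries.\<close>

lemma norm_diag_calculus:
  assumes bd: "bounded (range d)" and f: "f \<in> calculus_functions op_algebra (op_rep (diag d))"
  shows "norm (diag (\<lambda>n. f (d n))) = Sup (insert 0 ((\<lambda>z. cmod (f z)) ` closure (range d)))"
proof -
  have cont: "continuous_on (closure (range d)) f"
    using f by (simp add: calculus_functions_def spectrum_diag bd)
  have bdf: "bounded (range (\<lambda>n. f (d n)))" by (rule bounded_range_calculus[OF bd f])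
  have le: "cmod (f z) \<le> norm (diag (\<lambda>n. f (d n)))" if "z \<in> closure (range d)" for z
    using cont _ that by (rule continuous_on_closure_norm_le) (auto intro: norm_le_norm_diag[OF bdf])
  then have bdd: "bdd_above (insert 0 ((\<lambda>z. cmod (f z)) ` closure (range d)))"
    by (auto intro!: bdd_aboveI)
  show ?thesis
  proof (rule antisym)
    show "norm (diag (\<lambda>n. f (d n))) \<le> Sup (insert 0 ((\<lambda>z. cmod (f z)) ` closure (range d)))"
      by (intro norm_diag_le cSup_upper bdd insertI2 image_eqI refl closure_subset[THEN subsetD]) auto
    show "Sup (insert 0 ((\<lambda>z. cmod (f z)) ` closure (range d))) \<le> norm (diag (\<lambda>n. f (d n)))"
      using le by (intro cSup_least) auto
  qed
qed

lemma is_calculus_diag: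
  assumes bd: "bounded (range d)"
  shows "is_calculus op_algebra (op_rep (diag d)) (\<lambda>f. op_rep (diag (\<lambda>n. f (d n))))"
proof -
  have "diag (\<lambda>n. c * f (d n)) = scale_op c (diag (\<lambda>n. f (d n)))"
    if "f \<in> calculus_functions op_algebra (op_rep (diag d))" for c f
    unfolding scale_op_def by (subst diag_mult) (auto intro: bounded_range_calculus[OF bd that])
  then show ?thesis
    unfolding is_calculus_def
    by (simp add: op_rep_in_elems ops_diag norm_diag_calculus bd adj_diag spectrum_diag
        diag_add diag_mult bounded_range_calculus)
qed

section \<open>Uniqueness of the functional calculus on real spectra\<close>

lemma calculus_functions_add:
  "f \<in> calculus_functions A x \<Longrightarrow> g \<in> calculus_functions A x \<Longrightarrow>
    (\<lambda>z. f z + g z) \<in> calculus_functions A x"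
  and calculus_functions_mult:
  "f \<in> calculus_functions A x \<Longrightarrow> g \<in> calculus_functions A x \<Longrightarrow>
    (\<lambda>z. f z * g z) \<in> calculus_functions A x"
  and calculus_functions_scale:
  "f \<in> calculus_functions A x \<Longrightarrow> (\<lambda>z. c * f z) \<in> calculus_functions A x"
  and calculus_functions_ident: "(\<lambda>z. z) \<in> calculus_functions A x"
  by (auto simp: calculus_functions_def intro!: continuous_intros)

lemma is_calculusD:
  assumes "is_calculus A x \<phi>" "f \<in> calculus_functions A x"
  shows "\<phi> f \<in> elems A"
    and "anorm A (\<phi> f) = Sup (insert 0 ((\<lambda>z. cmod (f z)) ` spectrum A x))"
    and "\<phi> (\<lambda>z. c * f z) = ascale A c (\<phi> f)"
    and "g \<in> calculus_functions A x \<Longrightarrow> \<phi> (\<lambda>z. f z + g z) = aadd A (\<phi> f) (\<phi> g)"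
    and "g \<in> calculus_functions A x \<Longrightarrow> \<phi> (\<lambda>z. f z * g z) = amult A (\<phi> f) (\<phi> g)"
  using assms unfolding is_calculus_def by blast+

lemma is_calculus_ident: "is_calculus A x \<phi> \<Longrightarrow> \<phi> (\<lambda>z. z) = x"
  by (simp add: is_calculus_def)

text \<open>A calculus is linear and isometric, so uniform closeness on the spectrum becomes
  closeness in norm.\<close>

lemma calculus_dist_le:
  assumes \<phi>: "is_calculus op_algebra x \<phi>"
    and f: "f \<in> calculus_functions op_algebra x" and g: "g \<in> calculus_functions op_algebra x"
    and le: "\<And>z. z \<in> spectrum op_algebra x \<Longrightarrow> cmod (f z - g z) \<le> e" and "0 \<le> e"
  shows "dist (inv op_rep (\<phi> f)) (inv op_rep (\<phi> g)) \<le> e"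
proof -
  have g': "(\<lambda>z. - 1 * g z) \<in> calculus_functions op_algebra x"
    by (rule calculus_functions_scale[OF g])
  obtain S T where ST: "\<phi> f = op_rep S" "\<phi> g = op_rep T"
    using is_calculusD(1)[OF \<phi> f] is_calculusD(1)[OF \<phi> g] by auto
  have "\<phi> (\<lambda>z. f z + - 1 * g z) = op_rep (S - T)"
    unfolding is_calculusD(4)[OF \<phi> f g'] is_calculusD(3)[OF \<phi> g]
    by (simp add: ST scale_op_minus_one)
  then have "norm (S - T) = Sup (insert 0 ((\<lambda>z. cmod (f z - g z)) ` spectrum op_algebra x))"
    using is_calculusD(2)[OF \<phi> calculus_functions_add[OF f g']] by simp
  also have "\<dots> \<le> e"
    using le \<open>0 \<le> e\<close> by (intro cSup_least) auto
  finally show ?thesis by (simp add: ST dist_norm)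
qed

text \<open>Weierstrass approximation by polynomials without constant term, the only ones generated
  by the identity function alone.\<close>

lemma approx_polynomial_zero:
  fixes f :: "real \<Rightarrow> real"
  assumes "compact S" "continuous_on S f" "0 \<in> S \<Longrightarrow> f 0 = 0" "0 < e"
  obtains a n where "\<And>t. t \<in> S \<Longrightarrow> \<bar>f t - (\<Sum>i<n. a i * t ^ Suc i)\<bar> < e"
proof -
  define f' where "f' t = (if t = 0 then 0 else f t)" for t
  have "continuous_on (insert 0 S) f'"
  proof (cases "0 \<in> S")
    case True
    then have "f' = f" using assms(3) by (auto simp: f'_def)
    then show ?thesis using assms(2) True by (simp add: insert_absorb)
  next
    case False
    have "continuous_on ({0} \<union> S) f'"
    proof (rule continuous_on_closed_Un)
      show "continuous_on S f'"
        using assms(2) False by (subst continuous_on_cong[where g = f]) (auto simp: f'_def)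
    qed (use compact_imp_closed[OF assms(1)] in auto)
    then show ?thesis by simp
  qed
  moreover have "compact (insert 0 S)" using assms(1) by simp
  ultimately obtain g where "real_polynomial_function g"
    and g: "\<And>t. t \<in> insert 0 S \<Longrightarrow> \<bar>f' t - g t\<bar> < e / 2"
    using Stone_Weierstrass_real_polynomial_function[of "insert 0 S" f' "e / 2"] \<open>0 < e\<close> by auto
  then obtain a n where an: "g = (\<lambda>t. \<Sum>i\<le>n. a i * t ^ i)"
    by (auto simp: real_polynomial_function_iff_sum)
  have split: "g t = a 0 + (\<Sum>i<n. a (Suc i) * t ^ Suc i)" for t
    by (simp add: an sum.atMost_shift)
  have a0: "\<bar>a 0\<bar> < e / 2" using g[of 0] by (simp add: f'_def split)
  have close: "\<bar>f t - (a 0 + (\<Sum>i<n. a (Suc i) * t ^ Suc i))\<bar> < e / 2" if "t \<in> S" for t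
    using g[of t] assms(3) that unfolding split f'_def by (auto split: if_splits)
  have "\<bar>f t - (\<Sum>i<n. a (Suc i) * t ^ Suc i)\<bar> < e" if "t \<in> S" for t
    using a0 close[OF that] by linarith
  then show thesis by (rule that)
qed

text \<open>The functions on which the two calculi agree contain the identity and are closed under
  sums, products and complex multiples, hence contain all polynomials without constant term. These
  are uniformly dense, and both calculi are isometric.\<close>

lemma calculus_unique:
  assumes \<phi>: "is_calculus op_algebra x \<phi>" and \<psi>: "is_calculus op_algebra x \<psi>"
    and f: "f \<in> calculus_functions op_algebra x"
    and S: "compact S" "spectrum op_algebra x = complex_of_real ` S"
  shows "\<phi> f = \<psi> f"
proof -
  define P where "P p \<longleftrightarrow> p \<in> calculus_functions op_algebra x \<and> \<phi> p = \<psi> p" for p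
  have scale: "P (\<lambda>z. c * p z)" if "P p" for c p
    using that is_calculusD(3)[OF \<phi>] is_calculusD(3)[OF \<psi>]
    by (simp add: P_def calculus_functions_scale)
  have add: "P (\<lambda>z. p z + q z)" and mult: "P (\<lambda>z. p z * q z)" if "P p" "P q" for p q
    using that is_calculusD(4,5)[OF \<phi>] is_calculusD(4,5)[OF \<psi>]
    by (simp_all add: P_def calculus_functions_add calculus_functions_mult)
  have ident: "P (\<lambda>z. z)"
    by (simp add: P_def calculus_functions_ident is_calculus_ident[OF \<phi>] is_calculus_ident[OF \<psi>])
  have power: "P (\<lambda>z. z ^ Suc i)" for i
    by (induction i) (use ident mult[OF ident] in auto)
  have poly: "P (\<lambda>z. \<Sum>i<n. c i * z ^ Suc i)" for c n
  proof (induction n)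
    case 0
    show ?case using scale[OF ident, of 0] by simp
  next
    case (Suc n)
    show ?case using add[OF Suc.IH scale[OF power, of "c n" n]] by simp
  qed
  have "dist (inv op_rep (\<phi> f)) (inv op_rep (\<psi> f)) \<le> e" if "0 < e" for e
  proof -
    have cont: "continuous_on S (\<lambda>t. f (complex_of_real t))"
    proof (rule continuous_on_compose2[where g = f and f = complex_of_real])
      show "continuous_on (complex_of_real ` S) f" using f by (simp add: calculus_functions_def S)
    qed (auto intro: continuous_on_of_real)
    have f0: "f 0 = 0" if "0 \<in> S"
      using f imageI[OF that, of complex_of_real] by (simp add: calculus_functions_def S)
    \<comment> \<open>Real and imaginary part each contribute \<open>e / 4\<close>, which puts the
      polynomial within \<open>e / 2\<close> of \<open>f\<close>; each of the two calculi then
      contributes \<open>e / 2\<close>.\<close>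
    have e4: "0 < e / 4" using \<open>0 < e\<close> by simp
    have f0: "Re (f (complex_of_real 0)) = 0" "Im (f (complex_of_real 0)) = 0" if "0 \<in> S"
      using f0[OF that] by simp_all
    obtain a n where a: "\<And>t. t \<in> S \<Longrightarrow> \<bar>Re (f (complex_of_real t)) - (\<Sum>i<n. a i * t ^ Suc i)\<bar> < e / 4"
      using approx_polynomial_zero[OF S(1) continuous_on_Re[OF cont] f0(1) e4] by blast
    obtain b m where b: "\<And>t. t \<in> S \<Longrightarrow> \<bar>Im (f (complex_of_real t)) - (\<Sum>i<m. b i * t ^ Suc i)\<bar> < e / 4"
      using approx_polynomial_zero[OF S(1) continuous_on_Im[OF cont] f0(2) e4] by blast
    define p where "p z = (\<Sum>i<n. complex_of_real (a i) * z ^ Suc i) +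
        \<i> * (\<Sum>i<m. complex_of_real (b i) * z ^ Suc i)" for z
    have "P p" unfolding p_def by (intro add scale poly)
    have close: "cmod (f z - p z) \<le> e / 2" if z: "z \<in> spectrum op_algebra x" for z
    proof -
      obtain t where t: "t \<in> S" "z = complex_of_real t" using z unfolding S(2) by blast
      have p: "p z = complex_of_real (\<Sum>i<n. a i * t ^ Suc i) +
          \<i> * complex_of_real (\<Sum>i<m. b i * t ^ Suc i)"
        by (simp add: p_def t)
      have "cmod (f z - p z) \<le> \<bar>Re (f z - p z)\<bar> + \<bar>Im (f z - p z)\<bar>" by (rule cmod_le)
      also have "\<dots> = \<bar>Re (f z) - (\<Sum>i<n. a i * t ^ Suc i)\<bar> + \<bar>Im (f z) - (\<Sum>i<m. b i * t ^ Suc i)\<bar>"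
        by (simp only: p minus_complex.simps plus_complex.simps Re_complex_of_real Im_complex_of_real
            times_complex.simps imaginary_unit.simps)
      finally show ?thesis using a[OF t(1)] b[OF t(1)] unfolding t(2) by linarith
    qed
    have p: "p \<in> calculus_functions op_algebra x" "\<phi> p = \<psi> p"
      using \<open>P p\<close> by (simp_all add: P_def)
    have "dist (inv op_rep (\<phi> f)) (inv op_rep (\<phi> p)) \<le> e / 2"
      "dist (inv op_rep (\<psi> f)) (inv op_rep (\<psi> p)) \<le> e / 2"
      using calculus_dist_le[OF \<phi> f p(1) close] calculus_dist_le[OF \<psi> f p(1) close] \<open>0 < e\<close>
      by simp_all
    then show ?thesis
      using dist_triangle2[of "inv op_rep (\<phi> f)" "inv op_rep (\<psi> f)" "inv op_rep (\<phi> p)"]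
      unfolding p(2) by simp
  qed
  then have "inv op_rep (\<phi> f) = inv op_rep (\<psi> f)"
    by (metis dist_le_zero_iff field_le_epsilon add_0)
  then show ?thesis
    using is_calculusD(1)[OF \<phi> f] is_calculusD(1)[OF \<psi> f] by auto
qed

section \<open>Diagonal operators with real entries\<close>

definition real_diag :: "(nat \<Rightarrow> real) \<Rightarrow> l2 \<Rightarrow>\<^sub>L l2" where
  "real_diag a = diag (\<lambda>n. complex_of_real (a n))"

lemma bounded_range_of_real:
  "bounded (range a) \<Longrightarrow> bounded (range (\<lambda>n. complex_of_real (a n)))"
  by (simp add: bounded_iff)

lemma spectrum_real_diag:
  assumes "bounded (range a)"
  shows "spectrum op_algebra (op_rep (real_diag a)) = complex_of_real ` closure (range a)"
proof -
  have "closure (range (\<lambda>n. complex_of_real (a n))) = complex_of_real ` closure (range a)"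
  proof (rule antisym)
    have "compact (complex_of_real ` closure (range a))"
      using assms by (intro compact_continuous_image continuous_intros) auto
    then show "closure (range (\<lambda>n. complex_of_real (a n))) \<subseteq> complex_of_real ` closure (range a)"
      using closure_subset[of "range a"] by (intro closure_minimal compact_imp_closed) auto
    show "complex_of_real ` closure (range a) \<subseteq> closure (range (\<lambda>n. complex_of_real (a n)))"
      using closure_subset[of "range (\<lambda>n. complex_of_real (a n))"]
      by (intro image_closure_subset continuous_intros) auto
  qed
  then show ?thesis
    by (simp add: real_diag_def spectrum_diag bounded_range_of_real assms)
qed

text \<open>Resolves the definite description in \<open>fun_calculus\<close>: entrywise application
  is a calculus by \<open>is_calculus_diag\<close>, and \<open>calculus_unique\<close> applies since
  the spectrum is real and compact.\<close>

lemma fun_calculus_real_diag: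
  assumes a: "bounded (range a)"
    and f: "f \<in> calculus_functions op_algebra (op_rep (real_diag a))"
  shows "fun_calculus op_algebra f (op_rep (real_diag a)) = op_rep (diag (\<lambda>n. f (complex_of_real (a n))))"
proof -
  have calc: "is_calculus op_algebra (op_rep (real_diag a))
      (\<lambda>f. op_rep (diag (\<lambda>n. f (complex_of_real (a n)))))"
    unfolding real_diag_def by (rule is_calculus_diag[OF bounded_range_of_real[OF a]])
  have "compact (closure (range a))" using a by simp
  then show ?thesis
    unfolding fun_calculus_def
    using calculus_unique[OF _ calc f _ spectrum_real_diag[OF a]] calc
    by (intro the_equality) blast+
qed

lemma coord_real_diag:
  "bounded (range a) \<Longrightarrow> coord (real_diag a x) n = complex_of_real (a n) * coord x n"
  by (simp add: real_diag_def coord_diag bounded_range_of_real)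

lemma bounded_range_square:
  fixes a :: "nat \<Rightarrow> real"
  assumes "bounded (range a)"
  shows "bounded (range (\<lambda>n. (a n)\<^sup>2))"
proof -
  obtain M where M: "\<And>n. \<bar>a n\<bar> \<le> M" using assms by (auto simp: bounded_iff)
  have "norm ((a n)\<^sup>2) \<le> M\<^sup>2" for n
    using power_mono[OF M[of n], of 2] by simp
  then show ?thesis unfolding bounded_iff by blast
qed

lemma pos_sqrt_real_diag:
  assumes bd: "bounded (range a)" and nonneg: "\<And>n. 0 \<le> a n"
  shows "pos_sqrt op_algebra (op_rep (real_diag (\<lambda>n. (a n)\<^sup>2))) = op_rep (real_diag a)"
proof -
  have "(\<lambda>z. complex_of_real (sqrt (Re z)))
      \<in> calculus_functions op_algebra (op_rep (real_diag (\<lambda>n. (a n)\<^sup>2)))"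
    unfolding calculus_functions_def by (auto intro!: continuous_intros)
  from fun_calculus_real_diag[OF bounded_range_square[OF bd] this] show ?thesis
    using nonneg by (simp add: pos_sqrt_def real_diag_def)
qed

text \<open>The disjoint closed sets \<open>C\<close> and \<open>D\<close> cover the spectrum, so
  the indicator is continuous there; as 0 is outside \<open>C\<close> it also vanishes at 0. The
  complex set \<open>E\<close> stands for \<open>C\<close> on the spectrum.\<close>

lemma fun_calculus_indicator:
  assumes bd: "bounded (range a)"
    and C: "closed C" "closed D" "closure (range a) \<subseteq> C \<union> D" "C \<inter> D = {}" "0 \<notin> C"
    and E: "\<And>n. complex_of_real (a n) \<in> E \<longleftrightarrow> a n \<in> C"
      "\<And>t. t \<in> closure (range a) \<Longrightarrow> complex_of_real t \<in> E \<longleftrightarrow> t \<in> C"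
  shows "fun_calculus op_algebra (indicator E) (op_rep (real_diag a)) =
    op_rep (diag (\<lambda>n. indicator C (a n)))"
proof -
  let ?K = "complex_of_real ` closure (range a)"
  have closed: "closed (complex_of_real ` (closure (range a) \<inter> F))" if "closed F" for F
    using bd compact_Int_closed[OF _ that, of "closure (range a)"]
    by (intro compact_imp_closed compact_continuous_image continuous_intros) auto
  have "?K = complex_of_real ` (closure (range a) \<inter> C) \<union> complex_of_real ` (closure (range a) \<inter> D)"
    using C(3) by blast
  moreover have "continuous_on (complex_of_real ` (closure (range a) \<inter> C) \<union>
      complex_of_real ` (closure (range a) \<inter> D)) (indicator E :: complex \<Rightarrow> complex)"
  proof (rule continuous_on_closed_Un[OF closed[OF C(1)] closed[OF C(2)]])
    show "continuous_on (complex_of_real ` (closure (range a) \<inter> C)) (indicator E :: complex \<Rightarrow> complex)"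
      by (rule continuous_on_eq[OF continuous_on_const[of _ 1]]) (auto simp: E)
    show "continuous_on (complex_of_real ` (closure (range a) \<inter> D)) (indicator E :: complex \<Rightarrow> complex)"
      using C(4) by (intro continuous_on_eq[OF continuous_on_const[of _ 0]]) (auto simp: E indicator_def)
  qed
  moreover have "indicator E 0 = (0 :: complex)" if "0 \<in> ?K"
    using that E(2)[of 0] C(5) by (auto simp: indicator_def)
  ultimately have "indicator E \<in> calculus_functions op_algebra (op_rep (real_diag a))"
    by (simp add: calculus_functions_def spectrum_real_diag bd)
  from fun_calculus_real_diag[OF bd this] show ?thesis
    using E(1) by (simp add: indicator_def)
qed

section \<open>Weighted shifts as scaling elements\<close>

text \<open>The range of the shift lies in the odd coordinates, where the weight must be 1;
  \<open>e\<close> lists the weights left free.\<close>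

definition weights :: "(nat \<Rightarrow> real) \<Rightarrow> nat \<Rightarrow> real" where
  "weights e n = (if odd n then 1 else e (n div 2))"

text \<open>The diagonal of the absolute value of the adjoint: the weight at \<open>n\<close> is
  carried to \<open>2 * n + 1\<close>.\<close>

definition range_weights :: "(nat \<Rightarrow> real) \<Rightarrow> nat \<Rightarrow> real" where
  "range_weights e n = (if odd n then weights e (n div 2) else 0)"

definition weighted_shift :: "(nat \<Rightarrow> real) \<Rightarrow> seq_operator" where
  "weighted_shift e = op_rep (shift o\<^sub>L real_diag (weights e))"

lemma range_weights_eq: "range (range_weights e) = insert 0 (range (weights e))"
proof
  have "range_weights e 0 = 0" "range_weights e (2 * n + 1) = weights e n" for n
    by (simp_all add: range_weights_def)
  then show "insert 0 (range (weights e)) \<subseteq> range (range_weights e)"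
    by (metis image_subsetI insert_subset rangeI)
qed (auto simp: range_weights_def)

lemma range_weights: "range (weights e) = insert 1 (range e)"
proof
  have "weights e 1 = 1" "weights e (2 * n) = e n" for n
    by (simp_all add: weights_def)
  then show "insert 1 (range e) \<subseteq> range (weights e)"
    by (metis image_subsetI insert_subset rangeI)
qed (auto simp: weights_def)

context
  fixes e :: "nat \<Rightarrow> real"
  assumes bounded_e: "bounded (range e)" and e_nonneg: "\<And>n. 0 \<le> e n" and e0: "e 0 \<noteq> 0"
begin

lemma bounded_weights: "bounded (range (weights e))"
  and bounded_range_weights: "bounded (range (range_weights e))"
  using bounded_e by (simp_all add: range_weights_eq range_weights)

lemma weights_nonneg: "0 \<le> weights e n" "0 \<le> range_weights e n"
  by (simp_all add: range_weights_def weights_def e_nonneg)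

lemma weighted_shift_in_ops: "shift o\<^sub>L real_diag (weights e) \<in> ops"
  unfolding real_diag_def by (intro ops_compose ops_shift ops_diag)

lemma adj_weighted_shift:
  "adj (shift o\<^sub>L real_diag (weights e)) = real_diag (weights e) o\<^sub>L unshift"
  by (simp add: real_diag_def adj_compose ops_shift ops_diag adj_shift adj_diag)

lemmas coord_simps = coord_real_diag coord_shift coord_unshift bounded_weights
  bounded_range_weights bounded_range_square

lemma star_shift_shift:
  "real_diag (weights e) o\<^sub>L unshift o\<^sub>L (shift o\<^sub>L real_diag (weights e)) =
    real_diag (\<lambda>n. (weights e n)\<^sup>2)"
  by (intro blinfun_eqI l2_eqI) (simp add: coord_simps, simp add: power2_eq_square)

lemma shift_star_shift:
  "shift o\<^sub>L real_diag (weights e) o\<^sub>L (real_diag (weights e) o\<^sub>L unshift) =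
    real_diag (\<lambda>n. (range_weights e n)\<^sup>2)"
  by (intro blinfun_eqI l2_eqI)
    (auto simp add: coord_simps, auto simp: range_weights_def power2_eq_square)

lemma abs_weighted_shift:
  "abs_elem op_algebra (weighted_shift e) = op_rep (real_diag (weights e))"
  by (simp add: abs_elem_def weighted_shift_def adj_weighted_shift star_shift_shift
      pos_sqrt_real_diag bounded_weights weights_nonneg)

lemma abs_star_weighted_shift:
  "abs_elem op_algebra (astar op_algebra (weighted_shift e)) = op_rep (real_diag (range_weights e))"
  by (simp add: abs_elem_def weighted_shift_def adj_adj weighted_shift_in_ops)
    (simp add: adj_weighted_shift shift_star_shift
      pos_sqrt_real_diag bounded_range_weights weights_nonneg)

lemma spectrum_weighted_shift:
  "spectrum op_algebra (abs_elem op_algebra (astar op_algebra (weighted_shift e))) =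
    complex_of_real ` closure (insert 0 (insert 1 (range e)))"
  unfolding abs_star_weighted_shift spectrum_real_diag[OF bounded_range_weights]
    range_weights_eq range_weights ..

lemma scaling_weighted_shift: "scaling_element op_algebra (weighted_shift e)"
proof -
  \<comment> \<open>The image of the shift has only odd coordinates, and there the squared weight is
    1.\<close>
  have "real_diag (\<lambda>n. (weights e n)\<^sup>2) o\<^sub>L (shift o\<^sub>L real_diag (weights e)) =
      shift o\<^sub>L real_diag (weights e)"
    by (intro blinfun_eqI l2_eqI) (simp add: coord_simps, simp add: weights_def)
  \<comment> \<open>The diagonals differ at index 0, where they are the square of \<open>e 0\<close>
    and 0; this is the purpose of \<open>e0\<close>.\<close>
  moreover have "real_diag (\<lambda>n. (weights e n)\<^sup>2) \<noteq> real_diag (\<lambda>n. (range_weights e n)\<^sup>2)"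
  proof
    assume "real_diag (\<lambda>n. (weights e n)\<^sup>2) = real_diag (\<lambda>n. (range_weights e n)\<^sup>2)"
    then have "coord (real_diag (\<lambda>n. (weights e n)\<^sup>2) (unit_l2 0)) 0 =
        coord (real_diag (\<lambda>n. (range_weights e n)\<^sup>2) (unit_l2 0)) 0"
      by simp
    then show False
      using e0 by (simp add: coord_simps coord_unit_l2) (simp add: weights_def range_weights_def)
  qed
  ultimately show ?thesis
    by (simp add: scaling_element_def weighted_shift_def op_rep_in_elems weighted_shift_in_ops
        adj_weighted_shift star_shift_shift shift_star_shift)
qed

text \<open>When \<open>\<Omega> - {0, 1}\<close> is compact, both spectral projections are diagonal
  with entries 0 and 1, so their equality is a comparison of index sets.\<close>

lemma non_proper_weighted_shift_iff:
  assumes \<Omega>: "\<Omega> = closure (insert 0 (insert 1 (range e)))"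
  shows "non_proper_scaling_element op_algebra (weighted_shift e) \<longleftrightarrow>
    compact (\<Omega> - {0, 1}) \<and> (\<forall>n. weights e n = 1 \<longleftrightarrow> range_weights e n \<noteq> 0)"
proof -
  have img: "complex_of_real ` \<Omega> - {0, 1} = complex_of_real ` (\<Omega> - {0, 1})" by auto
  \<comment> \<open>The spectrum is a set of complex numbers; \<open>Re\<close> is a continuous
    inverse of the embedding of the reals.\<close>
  have compact_iff: "compact (complex_of_real ` S) \<longleftrightarrow> compact S" for S
  proof
    assume "compact (complex_of_real ` S)"
    then have "compact (Re ` complex_of_real ` S)"
      by (rule compact_continuous_image[rotated]) (intro continuous_intros)
    moreover have "Re ` complex_of_real ` S = S" by (simp add: image_image)
    ultimately show "compact S" by simp
  qed (intro compact_continuous_image continuous_intros)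
  have "fun_calculus op_algebra (indicator {1}) (op_rep (real_diag (weights e))) =
      fun_calculus op_algebra (indicator (complex_of_real ` \<Omega> - {0})) (op_rep (real_diag (range_weights e)))
    \<longleftrightarrow> (\<forall>n. weights e n = 1 \<longleftrightarrow> range_weights e n \<noteq> 0)"
    if "compact (\<Omega> - {0, 1})"
  proof -
    have closed: "closed (\<Omega> - {0, 1})" using that by (rule compact_imp_closed)
    have range: "closure (range (weights e)) \<subseteq> \<Omega>" "closure (range (range_weights e)) = \<Omega>"
      unfolding \<Omega> range_weights range_weights_eq by (rule closure_mono, blast, rule refl)
    have in\<Omega>: "range_weights e n \<in> \<Omega>" for n
      using closure_subset[of "range (range_weights e)"] range by auto
    have "fun_calculus op_algebra (indicator {1}) (op_rep (real_diag (weights e))) =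
        op_rep (diag (\<lambda>n. indicator {1} (weights e n)))"
      \<comment> \<open>The point 1 is split off from the rest of \<open>\<Omega>\<close>, which is
        closed because \<open>\<Omega> - {0, 1}\<close> is compact.\<close>
      by (rule fun_calculus_indicator[where D = "insert 0 (\<Omega> - {0, 1})"])
        (use range closed in \<open>auto simp: bounded_weights\<close>)
    moreover have "fun_calculus op_algebra (indicator (complex_of_real ` \<Omega> - {0}))
        (op_rep (real_diag (range_weights e))) =
        op_rep (diag (\<lambda>n. indicator (insert 1 (\<Omega> - {0, 1})) (range_weights e n)))"
      \<comment> \<open>Now 0 is split off. Since every range weight lies in
        \<open>\<Omega>\<close>, lying in the other piece means being nonzero.\<close>
      by (rule fun_calculus_indicator[where D = "{0}"])
        (use range closed in\<Omega> in \<open>auto simp: bounded_range_weights\<close>)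
    moreover have "diag (\<lambda>n. indicator C (a n)) = diag (\<lambda>n. indicator D (b n)) \<longleftrightarrow>
        (\<forall>n. a n \<in> C \<longleftrightarrow> b n \<in> D)" for C D :: "real set" and a b :: "nat \<Rightarrow> real"
    proof
      assume eq: "diag (\<lambda>n. indicator C (a n)) = diag (\<lambda>n. indicator D (b n))"
      have bd: "bounded (range (\<lambda>n. indicator C (a n) :: complex))" for C and a :: "nat \<Rightarrow> real"
        unfolding bounded_iff by (intro exI[of _ 1]) (auto simp: indicator_def)
      have "indicator C (a n) = (indicator D (b n) :: complex)" for n
        using arg_cong[OF eq, of "\<lambda>T. coord (T (unit_l2 n)) n"]
        by (simp add: coord_diag bd coord_unit_l2)
      then show "\<forall>n. a n \<in> C \<longleftrightarrow> b n \<in> D"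
        by (metis indicator_eq_0_iff)
    qed (auto simp: indicator_def)
    ultimately show ?thesis using in\<Omega> by auto
  qed
  then show ?thesis
    unfolding non_proper_scaling_element_def abs_weighted_shift abs_star_weighted_shift
      spectrum_weighted_shift[unfolded abs_star_weighted_shift, folded \<Omega>] img compact_iff
    using scaling_weighted_shift by blast
qed

end

section \<open>Choice of the weights and conclusion\<close>

lemma dense_sequence:
  fixes K :: "real set"
  assumes "closed K" "K \<noteq> {}"
  obtains e :: "nat \<Rightarrow> real" where "closure (range e) = K"
proof -
  obtain T where T: "countable T" "T \<subseteq> K" "K \<subseteq> closure T"
    by (rule separable)
  have "T \<noteq> {}" using T(3) assms(2) by auto
  then have "range (from_nat_into T) = T" using T(1) by (rule range_from_nat_into)
  moreover have "closure T = K" using T assms(1) by (simp add: closure_minimal subset_antisym)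
  ultimately show thesis using that by metis
qed

text \<open>The extra initial weight 1 leaves the closure unchanged, as 1 is in
  \<open>\<Omega>\<close>, and gives \<open>e 0 \<noteq> 0\<close>. It also breaks the criterion at
  index 0, where the weight is 1 but the range weight is 0.\<close>

lemma exists_proper_scaling_element:
  fixes \<Omega> :: "real set"
  assumes "compact \<Omega>" "{0, 1} \<subseteq> \<Omega>" "\<Omega> \<subseteq> {0..}"
  shows "\<exists>X. proper_scaling_element op_algebra X \<and>
    spectrum op_algebra (abs_elem op_algebra (astar op_algebra X)) = complex_of_real ` \<Omega>"
proof -
  obtain f :: "nat \<Rightarrow> real" where f: "closure (range f) = \<Omega>"
    using dense_sequence[of \<Omega>] assms compact_imp_closed by blast
  define e where "e = case_nat 1 f"
  have "range e = insert 1 (range f)"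
  proof
    have "e 0 = 1" "e (Suc n) = f n" for n by (simp_all add: e_def)
    then show "insert 1 (range f) \<subseteq> range e"
      by (metis image_subsetI insert_subset rangeI)
  qed (auto simp: e_def split: nat.splits)
  then have eq: "closure (insert 0 (insert 1 (range e))) = \<Omega>"
    using f assms(2) by (auto simp: closure_insert)
  have in\<Omega>: "e n \<in> \<Omega>" for n
    using eq closure_subset[of "insert 0 (insert 1 (range e))"] by auto
  have e: "bounded (range e)" "\<And>n. 0 \<le> e n" "e 0 \<noteq> 0"
    using in\<Omega> assms compact_imp_bounded[OF assms(1)]
    by (auto intro: bounded_subset simp: e_def)
  have "weights e 0 = 1" "range_weights e 0 = 0"
    by (simp_all add: weights_def range_weights_def e_def)
  then have "\<not> non_proper_scaling_element op_algebra (weighted_shift e)"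
    using non_proper_weighted_shift_iff[OF e eq[symmetric]] by blast
  then show ?thesis
    using scaling_weighted_shift[OF e] spectrum_weighted_shift[OF e] eq
    unfolding proper_scaling_element_def by metis
qed

text \<open>With all free weights in \<open>\<Omega> - {0, 1}\<close>, the weight 1 occurs exactly
  at the odd indices. No weight is 0, so the range weights are nonzero at exactly the same
  indices.\<close>

lemma exists_non_proper_scaling_element:
  fixes \<Omega> :: "real set"
  assumes "compact \<Omega>" "{0, 1} \<subseteq> \<Omega>" "\<Omega> \<subseteq> {0..}" "\<Omega> - {0, 1} \<noteq> {}" "compact (\<Omega> - {0, 1})"
  shows "\<exists>X. non_proper_scaling_element op_algebra X \<and>
    spectrum op_algebra (abs_elem op_algebra (astar op_algebra X)) = complex_of_real ` \<Omega>"
proof -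
  obtain e :: "nat \<Rightarrow> real" where cl: "closure (range e) = \<Omega> - {0, 1}"
    using dense_sequence[OF compact_imp_closed[OF assms(5)] assms(4)] by blast
  then have eq: "closure (insert 0 (insert 1 (range e))) = \<Omega>"
    using assms(2) by (auto simp: closure_insert)
  have in\<Omega>: "e n \<in> \<Omega> - {0, 1}" for n
    using cl closure_subset[of "range e"] by auto
  have e: "bounded (range e)" "\<And>n. 0 \<le> e n" "e 0 \<noteq> 0"
    using in\<Omega> assms compact_imp_bounded[OF assms(1)]
    by (auto intro: bounded_subset)
  have "weights e n = 1 \<longleftrightarrow> range_weights e n \<noteq> 0" for n
    using in\<Omega> by (auto simp: weights_def range_weights_def)
  then have "non_proper_scaling_element op_algebra (weighted_shift e)"
    using non_proper_weighted_shift_iff[OF e eq[symmetric]] assms(5) by blast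
  then show ?thesis
    using spectrum_weighted_shift[OF e] eq by metis
qed

theorem theoremB:
  fixes \<Omega> :: "real set"
  assumes "compact \<Omega>" and "{0, 1} \<subseteq> \<Omega>" and "\<Omega> \<subseteq> {0..}"
  shows "(\<exists>(A :: seq_operator cstar) X.
            cstar_algebra A \<and> scaling_element A X \<and>
            spectrum A (abs_elem A (astar A X)) = complex_of_real ` \<Omega>) \<and>
         (\<Omega> - {0, 1} \<noteq> {} \<and> compact (\<Omega> - {0, 1}) \<longrightarrow>
           (\<exists>(A :: seq_operator cstar) X.
              cstar_algebra A \<and> proper_scaling_element A X \<and>
              spectrum A (abs_elem A (astar A X)) = complex_of_real ` \<Omega>) \<and>
           (\<exists>(A :: seq_operator cstar) Y.
              cstar_algebra A \<and> non_proper_scaling_element A Y \<and>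
              spectrum A (abs_elem A (astar A Y)) = complex_of_real ` \<Omega>))"
proof (intro conjI impI)
  \<comment> \<open>The proper element exists for every admissible \<open>\<Omega>\<close>, so it
    also settles the first claim.\<close>
  show proper: "\<exists>(A :: seq_operator cstar) X. cstar_algebra A \<and> proper_scaling_element A X \<and>
      spectrum A (abs_elem A (astar A X)) = complex_of_real ` \<Omega>"
    using exists_proper_scaling_element[OF assms] cstar_op_algebra by blast
  then show "\<exists>(A :: seq_operator cstar) X. cstar_algebra A \<and> scaling_element A X \<and>
      spectrum A (abs_elem A (astar A X)) = complex_of_real ` \<Omega>"
    unfolding proper_scaling_element_def by blast
  show "\<exists>(A :: seq_operator cstar) Y. cstar_algebra A \<and> non_proper_scaling_element A Y \<and>
      spectrum A (abs_elem A (astar A Y)) = complex_of_real ` \<Omega>"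
    if "\<Omega> - {0, 1} \<noteq> {} \<and> compact (\<Omega> - {0, 1})"
    using exists_non_proper_scaling_element[OF assms] that cstar_op_algebra by blast
qed

end
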